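(* Let $d\ge 2$, let $\Gamma\subset\mathbb{R}^d$ be a $C^2$ convex surface and let $Q'\subset\mathbb{R}^{d-1}$ be a cube over which $\Gamma$ is the graph $\{(x',g(x')):x'\in Q'\}$ of a strictly convex $C^2$ function $g$ for which there are constants $0<c_0<C_0$ such that $c_0\,\mathrm{Id}\le D^2g(x')\le C_0\,\mathrm{Id}$ (as symmetric matrices) for all $x'\in Q'$. For each $\varepsilon>0$ let $I_\varepsilon\subset[0,1)$ be an interval of length $|I_\varepsilon|$, and let $$A_\varepsilon=\#\left\{k'\in\mathbb{Z}^{d-1}\cap\varepsilon^{-1}Q' : \frac{g(\varepsilon k')}{\varepsilon}\in I_\varepsilon \pmod 1\right\},\qquad N_\varepsilon=\#\left\{k'\in\mathbb{Z}^{d-1}\cap\varepsilon^{-1}Q'\right\}.$$ Then $$\left|\frac{A_\varepsilon}{N_\varepsilon}-|I_\varepsilon|\right|=O(\varepsilon^{1/3})\qquad\text{as }\varepsilon\to0.$$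
   Context: Here $\varepsilon^{-1}Q'=\{\varepsilon^{-1}x':x'\in Q'\}$, $\#$ denotes the number of elements of a finite set, and $s\in I \pmod 1$ means that the fractional part of $s$ belongs to $I$. *)

theory Defs
  imports "HOL-Analysis.Analysis" "HOL-Library.Landau_Symbols"
begin

text \<open>
  Euclidean space of dimension \<open>d - 1\<close> is \<open>real ^ 'n\<close> with \<open>CARD('n) = d - 1\<close>; types are
  nonempty, so \<open>d \<ge> 2\<close>. Euclidean space of dimension \<open>d\<close> is \<open>(real ^ 'n) \<times> real\<close>.
\<close>

text \<open>
  A nondegenerate cube in arbitrary position, not necessarily parallel to the axes; the edge
  \<open>J\<close> may be open, closed or half-open.
\<close>

definition is_cube :: "(real ^ 'n) set \<Rightarrow> bool" where
  "is_cube Q \<longleftrightarrow> (\<exists>(J :: real set) (f :: real ^ 'n \<Rightarrow> real ^ 'n) a. is_interval J \<and> bounded J \<and> interior J \<noteq> {} \<and>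
     orthogonal_transformation f \<and> Q = (\<lambda>x. a + f x) ` {x. \<forall>i. x $ i \<in> J})"

text \<open>
  \<open>f\<close> is \<open>C\<^sup>2\<close> on \<open>S\<close> with gradient \<open>G\<close> and Hessian \<open>D\<close>. At boundary points contained in \<open>S\<close>
  the derivatives are taken within \<open>S\<close>; they are unique when \<open>S\<close> is open or is a cube.
\<close>

definition C2_on ::
  "'a::euclidean_space set \<Rightarrow> ('a \<Rightarrow> real) \<Rightarrow> ('a \<Rightarrow> 'a) \<Rightarrow> ('a \<Rightarrow> 'a \<Rightarrow>\<^sub>L 'a) \<Rightarrow> bool" where
  "C2_on S f G D \<longleftrightarrow>
     (\<forall>x\<in>S. (f has_derivative (\<lambda>h. G x \<bullet> h)) (at x within S)) \<and>
     (\<forall>x\<in>S. (G has_derivative blinfun_apply (D x)) (at x within S)) \<and>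
     continuous_on S D"

definition strictly_convex_on :: "'a::real_vector set \<Rightarrow> ('a \<Rightarrow> real) \<Rightarrow> bool" where
  "strictly_convex_on S f \<longleftrightarrow> convex S \<and>
     (\<forall>x\<in>S. \<forall>y\<in>S. \<forall>t. x \<noteq> y \<longrightarrow> 0 < t \<longrightarrow> t < 1 \<longrightarrow>
        f ((1 - t) *\<^sub>R x + t *\<^sub>R y) < (1 - t) * f x + t * f y)"

definition psd :: "real ^ 'n ^ 'n \<Rightarrow> bool" where
  "psd A \<longleftrightarrow> transpose A = A \<and> (\<forall>v. 0 \<le> v \<bullet> (A *v v))"

definition loewner_le :: "real ^ 'n ^ 'n \<Rightarrow> real ^ 'n ^ 'n \<Rightarrow> bool" where
  "loewner_le A B \<longleftrightarrow> psd (B - A)"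

text \<open>
  A \<open>C\<^sup>2\<close> convex surface: a piece \<open>M\<close> of the boundary of a convex set \<open>K\<close> with interior points,
  such that near every point of \<open>M\<close> that boundary is a regular level set of a \<open>C\<^sup>2\<close> function.
  \<open>M\<close> may be the whole boundary, a relatively open piece, or a piece including (some of) its
  own edge; the closure condition excludes lower-dimensional pieces.
\<close>

definition C2_convex_surface :: "'a::euclidean_space set \<Rightarrow> bool" where
  "C2_convex_surface M \<longleftrightarrow> M \<noteq> {} \<and>
     (\<exists>K. convex K \<and> closed K \<and> interior K \<noteq> {} \<and> M \<subseteq> frontier K \<and>
        M \<subseteq> closure (top_of_set (frontier K) interior_of M) \<and>
        (\<forall>p\<in>M. \<exists>U \<phi> G D. open U \<and> p \<in> U \<and> C2_on U \<phi> G D \<and> (\<forall>x\<in>U. G x \<noteq> 0) \<and>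
           frontier K \<inter> U = {x \<in> U. \<phi> x = 0}))"

text \<open>
  Localisation to an open \<open>V\<close> is needed because a closed surface has a second sheet over \<open>Q\<close>.
\<close>

definition is_graph_over ::
  "('a::topological_space \<times> real) set \<Rightarrow> 'a set \<Rightarrow> ('a \<Rightarrow> real) \<Rightarrow> bool" where
  "is_graph_over M Q g \<longleftrightarrow>
     (\<exists>V. open V \<and> M \<inter> V \<inter> (Q \<times> UNIV) = (\<lambda>x. (x, g x)) ` Q)"

definition lattice_pts :: "(real ^ 'n) set \<Rightarrow> real \<Rightarrow> (real ^ 'n) set" where
  "lattice_pts Q \<epsilon> = {k. \<forall>i. k $ i \<in> \<int>} \<inter> (\<lambda>x. inverse \<epsilon> *\<^sub>R x) ` Q"

definition N_count :: "(real ^ 'n) set \<Rightarrow> real \<Rightarrow> nat" where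
  "N_count Q \<epsilon> = card (lattice_pts Q \<epsilon>)"

definition A_count :: "(real ^ 'n) set \<Rightarrow> (real ^ 'n \<Rightarrow> real) \<Rightarrow> real set \<Rightarrow> real \<Rightarrow> nat" where
  "A_count Q g I \<epsilon> = card {k \<in> lattice_pts Q \<epsilon>. frac (g (\<epsilon> *\<^sub>R k) / \<epsilon>) \<in> I}"

end

theory Submission
  imports Defs
begin

text \<open>
  Fix a coordinate axis and cut the lattice points of \<open>Q / \<epsilon>\<close> into lines parallel to it. On each
  line the sequence \<open>g (\<epsilon> k) / \<epsilon>\<close> has \<open>O(1 / \<epsilon>)\<close> terms, and its second differences lie between
  \<open>c\<^sub>0 \<epsilon>\<close> and \<open>C\<^sub>0 \<epsilon>\<close> by the bounds on the Hessian (\<open>second_difference_bounds\<close>). It is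
  enough to show that on each line the number of terms whose fractional part lies in \<open>I\<close> differs
  from its expected value by \<open>O(\<epsilon> powr (- 2 / 3))\<close>, uniformly in \<open>I\<close>. With \<open>n = d - 1\<close> there are
  \<open>O(\<epsilon> powr (1 - n))\<close> lines, and at least a multiple of \<open>\<epsilon> powr (- n)\<close> lattice points
  altogether, so the relative error is \<open>O(\<epsilon> powr (1 / 3))\<close> (\<open>lattice_discrepancy\<close>).

  The one-dimensional statement is a classical application of exponential sums. The indicator
  of \<open>[a, b)\<close> modulo 1 is \<open>b - a\<close> plus a difference of two translates of the sawtooth
  \<open>frac y - 1/2\<close>, so a bound for sawtooth sums suffices. Because the sawtooth increases with slope
  1 and jumps downwards, it is enclosed, up to an error \<open>\<delta>\<close>, between its averages over intervals of
  length \<open>\<delta> = 1 / J\<close> to the left and to the right. These averages are difference quotients of the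
  periodic quadratic \<open>(frac y)\<^sup>2 - frac y\<close>, whose Fourier series converges absolutely
  (\<open>dilog_cos_1\<close>). This reduces sawtooth sums to the exponential sums of \<open>j * f m\<close>
  (\<open>sum_sawtooth_le\<close>), where frequencies above \<open>J\<close> are damped.

  For these sums van der Corput's second derivative test, in the form of a condition on second
  differences (\<open>van_der_Corput_second_difference\<close>), gives the bound \<open>O(sqrt (j / \<epsilon>))\<close>. The
  sawtooth sum is then at most of order \<open>1 / (\<epsilon> * J) + sqrt (J / \<epsilon>)\<close>, and the choice
  \<open>J = \<epsilon> powr (- 1 / 3)\<close> yields \<open>\<epsilon> powr (- 2 / 3)\<close> (\<open>sum_sawtooth_curved_le\<close>).
\<close>

section \<open>The Fourier series of a quadratic polynomial\<close>

text \<open>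
  Keeps \<open>1 - r * cis (2 * pi * t)\<close> in the right half plane, off the branch cut of the logarithm, up to
  and including \<open>r = 1\<close>; the point \<open>t = 0\<close>, where the logarithm is singular, has to be excluded.
\<close>

lemma one_minus_cos_pos:
  assumes "0 < t" "t < (1::real)" "0 \<le> r" "r \<le> 1"
  shows "0 < 1 - r * cos (2 * pi * t)"
proof -
  have "0 < sin (pi * t)" using assms by (intro sin_gt_zero) auto
  moreover have "cos (2 * pi * t) = 1 - 2 * sin (pi * t) ^ 2"
    using cos_double_sin[of "pi * t"] by (simp add: mult.assoc)
  ultimately have "cos (2 * pi * t) < 1" by simp
  show ?thesis
  proof (cases "cos (2 * pi * t) \<le> 0")
    case True
    then have "r * cos (2 * pi * t) \<le> 0" using assms by (simp add: mult_nonneg_nonpos)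
    then show ?thesis by simp
  next
    case False
    then have "r * cos (2 * pi * t) \<le> 1 * cos (2 * pi * t)" using assms by (intro mult_right_mono) auto
    then show ?thesis using \<open>cos (2 * pi * t) < 1\<close> by simp
  qed
qed

text \<open>
  In polar form \<open>1 - cis (2 * pi * t)\<close> is \<open>2 * sin (pi * t)\<close> times \<open>cis (pi * t - pi / 2)\<close>. This is where
  the linear function, which integrates to the quadratic polynomial below, enters.
\<close>

lemma Im_Ln_one_minus_cis:
  assumes "0 < t" "t < 1"
  shows "Im (Ln (1 - cis (2 * pi * t))) = pi * (t - 1/2)"
proof -
  have s: "0 < sin (pi * t)" using assms by (intro sin_gt_zero) auto
  define w where "w = of_real (ln (2 * sin (pi * t))) + \<i> * of_real (pi * (t - 1/2))"
  have "exp w = of_real (2 * sin (pi * t)) * cis (pi * t - pi / 2)"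
    using s by (simp add: w_def exp_add exp_of_real cis_conv_exp right_diff_distrib)
  also have "\<dots> = 1 - cis (2 * pi * t)"
    using cos_double_sin[of "pi * t"] sin_double[of "pi * t"]
    by (simp add: complex_eq_iff cos_diff sin_diff power2_eq_square mult.assoc)
  finally have "Ln (1 - cis (2 * pi * t)) = w"
  proof (intro Ln_unique)
    have "pi * t < pi" "0 < pi * t" using assms by auto
    moreover have "Im w = pi * t - pi / 2" by (simp add: w_def right_diff_distrib)
    ultimately show "- pi < Im w" "Im w \<le> pi" by linarith+
  qed auto
  then show ?thesis by (simp add: w_def)
qed

text \<open>
  The real part of the dilogarithm at \<open>r * cis (2 * pi * x)\<close>. The series of interest is the one at
  \<open>r = 1\<close>; the radius \<open>r < 1\<close> makes termwise differentiation legitimate.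
\<close>

definition dilog_cos :: "real \<Rightarrow> real \<Rightarrow> real" where
  "dilog_cos r x = (\<Sum>n. r ^ Suc n * cos (2 * pi * real (Suc n) * x) / real (Suc n) ^ 2)"

lemma summable_inverse_Suc_squares: "summable (\<lambda>n. 1 / real (Suc n) ^ 2)"
  using inverse_squares_sums by (simp add: sums_iff add.commute)

lemma dilog_cos_bound:
  assumes "0 \<le> r" "r \<le> (1::real)"
  shows "norm (r ^ Suc n * cos (2 * pi * real (Suc n) * x) / real (Suc n) ^ 2) \<le> 1 / real (Suc n) ^ 2"
proof -
  have "\<bar>r ^ Suc n\<bar> * \<bar>cos (2 * pi * real (Suc n) * x)\<bar> \<le> 1 * 1"
    using assms by (intro mult_mono) (auto intro!: mult_le_one power_le_one simp del: power_Suc)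
  then show ?thesis by (simp add: abs_mult divide_right_mono del: power_Suc)
qed

lemma continuous_on_dilog_cos: "continuous_on UNIV (dilog_cos 1)"
proof -
  have "uniform_limit UNIV (\<lambda>n x. \<Sum>i<n. 1 ^ Suc i * cos (2 * pi * real (Suc i) * x) / real (Suc i) ^ 2)
     (\<lambda>x. dilog_cos 1 x) sequentially"
    unfolding dilog_cos_def
    by (rule Weierstrass_m_test[OF dilog_cos_bound summable_inverse_Suc_squares]) auto
  then show ?thesis
    by (rule uniform_limit_theorem[rotated]) (auto intro!: always_eventually continuous_intros)
qed

lemma dilog_cos_tendsto:
  "((\<lambda>r. dilog_cos r x) \<longlongrightarrow> dilog_cos 1 x) (at_left 1)"
proof -
  have "uniform_limit {0..1} (\<lambda>n r. \<Sum>i<n. r ^ Suc i * cos (2 * pi * real (Suc i) * x) / real (Suc i) ^ 2)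
     (\<lambda>r. dilog_cos r x) sequentially"
    unfolding dilog_cos_def
    by (rule Weierstrass_m_test[OF dilog_cos_bound summable_inverse_Suc_squares]) auto
  then have "continuous_on {0..1} (\<lambda>r. dilog_cos r x)"
    by (rule uniform_limit_theorem[rotated]) (auto intro!: always_eventually continuous_intros)
  then have "((\<lambda>r. dilog_cos r x) \<longlongrightarrow> dilog_cos 1 x) (at 1 within {0..1})"
    by (auto simp: continuous_on_def)
  then show ?thesis by (simp add: at_within_Icc_at_left)
qed

lemma sums_Im_Ln:
  assumes "0 \<le> r" "r < 1"
  shows "(\<lambda>n. - (2 * pi * r ^ Suc n * sin (2 * pi * real (Suc n) * x)) / real (Suc n)) sums
      (2 * pi * Im (Ln (1 - r * cis (2 * pi * x))))"
proof -
  have "(\<lambda>n. - ((-(- (r * cis (2 * pi * x))))^n) / of_nat n) sums Ln (1 + (- (r * cis (2 * pi * x))))"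
    using assms by (intro Ln_series') (simp add: norm_mult)
  then have "(\<lambda>n. Im (- ((r * cis (2 * pi * x))^n) / of_nat n)) sums Im (Ln (1 - r * cis (2 * pi * x)))"
    by (intro sums_Im) simp
  then have "(\<lambda>n. Im (- ((r * cis (2 * pi * x))^Suc n) / of_nat (Suc n))) sums Im (Ln (1 - r * cis (2 * pi * x)))"
    by (subst sums_Suc_iff) simp
  moreover have "Im (- ((r * cis (2 * pi * x))^Suc n) / of_nat (Suc n))
     = - (r ^ Suc n * sin (2 * pi * real (Suc n) * x)) / real (Suc n)" for n
  proof -
    have "(r * cis (2 * pi * x))^Suc n = of_real (r ^ Suc n) * cis (2 * pi * real (Suc n) * x)"
      unfolding power_mult_distrib Complex.DeMoivre by (simp add: mult_ac)
    then show ?thesis by (simp only: Im_divide_of_nat) simp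
  qed
  ultimately have "(\<lambda>n. - (r ^ Suc n * sin (2 * pi * real (Suc n) * x)) / real (Suc n)) sums Im (Ln (1 - r * cis (2 * pi * x)))"
    by (simp only:)
  from sums_mult[OF this, of "2 * pi"] show ?thesis by (simp add: mult_ac)
qed

lemma dilog_cos_deriv:
  assumes r: "0 \<le> r" "r < 1"
  shows "(dilog_cos r has_field_derivative (2 * pi * Im (Ln (1 - r * cis (2 * pi * x))))) (at x)"
proof -
  let ?f' = "\<lambda>n x. - (2 * pi * r ^ Suc n * sin (2 * pi * real (Suc n) * x)) / real (Suc n)"
  have "((\<lambda>x. \<Sum>n. r ^ Suc n * cos (2 * pi * real (Suc n) * x) / real (Suc n) ^ 2)
      has_field_derivative (\<Sum>n. ?f' n x)) (at x)"
  proof (rule has_field_derivative_series'(2)[where S=UNIV and ?x0.0=0])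
    show "((\<lambda>x. r ^ Suc n * cos (2 * pi * real (Suc n) * x) / real (Suc n) ^ 2)
      has_field_derivative ?f' n x) (at x within UNIV)" for n x
      by (rule derivative_eq_intros refl | simp del: of_nat_Suc power_Suc)+
        (simp add: divide_simps power2_eq_square power4_eq_xxxx mult.assoc del: of_nat_Suc power_Suc)
    show "uniformly_convergent_on UNIV (\<lambda>n x. \<Sum>i<n. ?f' i x)"
    proof (rule Weierstrass_m_test')
      show "summable (\<lambda>n. 2 * pi * r ^ n)"
        using r by (intro summable_mult summable_geometric) auto
      fix n x
      have 1: "\<bar>sin (2 * pi * real (Suc n) * x)\<bar> \<le> real (Suc n)"
        by (rule order.trans[OF abs_sin_le_one]) simp
      have 2: "r ^ Suc n \<le> r ^ n" using r by (intro power_decreasing) auto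
      have "\<bar>2 * pi * r ^ Suc n * sin (2 * pi * real (Suc n) * x)\<bar> = 2 * pi * r ^ Suc n * \<bar>sin (2 * pi * real (Suc n) * x)\<bar>"
        using r by (simp add: abs_mult)
      also have "\<dots> \<le> (2 * pi * r ^ n) * real (Suc n)"
        using r 1 2 by (intro mult_mono) auto
      finally show "norm (?f' n x) \<le> 2 * pi * r ^ n"
        by (simp add: pos_divide_le_eq del: of_nat_Suc power_Suc)
    qed
    show "summable (\<lambda>n. r ^ Suc n * cos (2 * pi * real (Suc n) * 0) / real (Suc n) ^ 2)"
      by (rule summable_comparison_test'[OF summable_inverse_Suc_squares dilog_cos_bound]) (use r in auto)
  qed auto
  then show ?thesis
    using sums_unique[OF sums_Im_Ln[OF r, of x]] by (simp add: dilog_cos_def[abs_def])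
qed

text \<open>
  At \<open>r = 1\<close> the differentiated series converges only conditionally. The derivative is obtained
  instead as the limit of the derivatives for \<open>r < 1\<close>: on a compact subinterval of \<open>(0, 1)\<close> these
  converge uniformly, because the logarithm is uniformly continuous on the compact set of
  arguments that occur.
\<close>

lemma dilog_cos_1_deriv:
  assumes "0 < x" "x < (1::real)"
  shows "(dilog_cos 1 has_field_derivative (pi^2 * (2 * x - 1))) (at x)"
proof -
  define a b where "a = x / 2" and "b = (1 + x) / 2"
  have ab: "0 < a" "a < x" "x < b" "b < 1" using assms by (auto simp: a_def b_def)
  define rr where "rr = (\<lambda>n::nat. 1 - 1 / real (Suc n))"
  have rr: "0 \<le> rr n" "rr n < 1" for n by (auto simp: rr_def)
  have rr_lim: "rr \<longlonglongrightarrow> 1" unfolding rr_def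
    using tendsto_diff[OF tendsto_const LIMSEQ_inverse_real_of_nat, of 1] by (simp add: inverse_eq_divide)
  have rr_lim': "filterlim rr (at_left 1) sequentially"
    using rr_lim rr(2) less_imp_neq[OF rr(2)] unfolding filterlim_at by (auto intro!: always_eventually)
  define v where "v = (\<lambda>p :: real \<times> real. Im (Ln (1 - of_real (fst p) * cis (2 * pi * snd p))))"
  have "continuous_on ({0..1} \<times> {a..b}) v" unfolding v_def
  proof (intro continuous_intros)
    fix p :: "real \<times> real" assume p: "p \<in> {0..1} \<times> {a..b}"
    then have "0 < Re (1 - of_real (fst p) * cis (2 * pi * snd p))"
      using one_minus_cos_pos[of "snd p" "fst p"] ab by auto
    then show "1 - complex_of_real (fst p) * cis (2 * pi * snd p) \<notin> \<real>\<^sub>\<le>\<^sub>0"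
      by (auto simp: complex_nonpos_Reals_iff)
  qed
  then have uc: "uniformly_continuous_on ({0..1} \<times> {a..b}) v"
    by (intro compact_uniformly_continuous compact_Times compact_Icc)
  have "\<exists>g. \<forall>y\<in>{a..b}. (\<lambda>n. dilog_cos (rr n) y) \<longlonglongrightarrow> g y \<and>
      (g has_derivative (\<lambda>h. 2 * pi * v (1, y) * h)) (at y within {a..b})"
  proof (rule has_derivative_sequence)
    show "(dilog_cos (rr n) has_derivative (\<lambda>h. 2 * pi * v (rr n, y) * h)) (at y within {a..b})" for n y
      using dilog_cos_deriv[OF rr, THEN has_field_derivative_at_within, of n y "{a..b}"]
      by (simp add: has_field_derivative_def v_def)
    show "a \<in> {a..b}" using ab by auto
    show "(\<lambda>n. dilog_cos (rr n) a) \<longlonglongrightarrow> dilog_cos 1 a"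
      by (rule filterlim_compose[OF dilog_cos_tendsto rr_lim'])
    fix e :: real assume "e > 0"
    then obtain d where d: "d > 0" and
      D: "\<And>p q :: real \<times> real. p \<in> {0..1} \<times> {a..b} \<Longrightarrow> q \<in> {0..1} \<times> {a..b} \<Longrightarrow> dist p q < d \<Longrightarrow> dist (v p) (v q) < e / (2 * pi)"
      using uc[unfolded uniformly_continuous_on_def, rule_format, of "e / (2 * pi)"]
      by (auto simp: dist_commute)
    have "\<forall>\<^sub>F n in sequentially. dist (rr n) 1 < d" using rr_lim d by (rule tendstoD)
    then show "\<forall>\<^sub>F n in sequentially. \<forall>y\<in>{a..b}. \<forall>h. norm (2 * pi * v (rr n, y) * h - 2 * pi * v (1, y) * h) \<le> e * norm h"
    proof eventually_elim
      case (elim n)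
      show ?case
      proof (intro ballI allI)
        fix y h assume y: "y \<in> {a..b}"
        have "dist (v (rr n, y)) (v (1, y)) < e / (2 * pi)"
          using y rr[of n] elim by (intro D) (auto simp: dist_Pair_Pair)
        then have "2 * pi * \<bar>v (rr n, y) - v (1, y)\<bar> \<le> e" by (simp add: dist_real_def field_simps)
        moreover have "norm (2 * pi * v (rr n, y) * h - 2 * pi * v (1, y) * h)
          = (2 * pi * \<bar>v (rr n, y) - v (1, y)\<bar>) * \<bar>h\<bar>"
          by (simp add: abs_mult flip: left_diff_distrib right_diff_distrib)
        ultimately show "norm (2 * pi * v (rr n, y) * h - 2 * pi * v (1, y) * h) \<le> e * norm h"
          by (simp add: mult_right_mono)
      qed
    qed
  qed auto
  then obtain g where g: "\<And>y. y \<in> {a..b} \<Longrightarrow> (\<lambda>n. dilog_cos (rr n) y) \<longlonglongrightarrow> g y"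
     "\<And>y. y \<in> {a..b} \<Longrightarrow> (g has_derivative (\<lambda>h. 2 * pi * v (1, y) * h)) (at y within {a..b})"
    by blast
  have geq: "g y = dilog_cos 1 y" if "y \<in> {a..b}" for y
  proof (rule LIMSEQ_unique[OF g(1)[OF that]])
    show "(\<lambda>n. dilog_cos (rr n) y) \<longlonglongrightarrow> dilog_cos 1 y"
      by (rule filterlim_compose[OF dilog_cos_tendsto rr_lim'])
  qed
  have "(g has_derivative (\<lambda>h. 2 * pi * v (1, x) * h)) (at x)"
    using g(2)[of x] ab by (simp add: at_within_Icc_at)
  then have "(g has_field_derivative (2 * pi * v (1, x))) (at x)"
    by (simp add: has_field_derivative_def)
  then have "(dilog_cos 1 has_field_derivative (2 * pi * v (1, x))) (at x)"
    by (rule DERIV_cong_ev[THEN iffD1, rotated 3])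
      (use ab geq in \<open>auto intro!: eventually_mono[OF eventually_nhds_in_open[of "{a<..<b}" x]]\<close>)
  moreover have "2 * pi * v (1, x) = pi^2 * (2 * x - 1)"
    using Im_Ln_one_minus_cis[OF assms] by (simp add: v_def power2_eq_square right_diff_distrib)
  ultimately show ?thesis by simp
qed

text \<open>
  The derivative is available on the open interval only; continuity of the series at \<open>r = 1\<close>
  carries the identity to the end points.
\<close>

lemma dilog_cos_1:
  assumes "0 \<le> x" "x \<le> (1::real)"
  shows "dilog_cos 1 x = dilog_cos 1 0 + pi^2 * (x^2 - x)"
proof (cases "x = 0")
  case False
  define D where "D = (\<lambda>x. dilog_cos 1 x - pi^2 * (x^2 - x))"
  have "D x = D 0"
  proof (rule DERIV_isconst2[of 0 1])
    show "continuous_on {0..1} D" unfolding D_def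
      by (intro continuous_intros continuous_on_subset[OF continuous_on_dilog_cos]) auto
    show "(D has_real_derivative 0) (at t)" if "0 < t" "t < 1" for t
      unfolding D_def by (auto intro!: derivative_eq_intros dilog_cos_1_deriv[OF that])
  qed (use assms False in auto)
  then show ?thesis by (simp add: D_def)
qed simp

section \<open>Exponential sums\<close>

abbreviation ee :: "real \<Rightarrow> complex" where "ee x \<equiv> cis (2 * pi * x)"

text \<open>
  Jordan's inequality, reflected about \<open>1/2\<close>.
\<close>

lemma sin_pi_ge:
  assumes "0 < \<theta>" "\<theta> \<le> x" "x \<le> 1 - \<theta>"
  shows "2 * \<theta> \<le> sin (pi * x)"
proof -
  have jordan: "2 * y \<le> sin (pi * y)" if "0 \<le> y" "y \<le> 1/2" for y
  proof -
    have "concave_on {0..pi} sin"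
      by (intro f''_le0_imp_concave[where f' = cos and f'' = "\<lambda>x. - sin x"])
         (auto intro!: derivative_eq_intros sin_ge_zero)
    then have "convex_on {0..pi} (\<lambda>x. - sin x)" by (simp add: concave_on_def)
    from convex_onD[OF this, of "2 * y" 0 "pi/2"] that
    show ?thesis by (simp add: field_simps)
  qed
  show ?thesis
  proof (cases "x \<le> 1/2")
    case True
    then show ?thesis using jordan[of x] assms by linarith
  next
    case False
    have "sin (pi * (1 - x)) = sin (pi * x)" by (simp add: right_diff_distrib sin_diff)
    then show ?thesis using jordan[of "1 - x"] assms False by simp
  qed
qed

lemma norm_ee_minus_1: "norm (ee x - 1) = 2 * \<bar>sin (pi * x)\<bar>"
proof -
  have "ee x - 1 = of_real (2 * sin (pi * x)) * (\<i> * cis (pi * x))"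
    using cos_double_sin[of "pi * x"] sin_double[of "pi * x"]
    by (simp add: complex_eq_iff power2_eq_square mult.assoc)
  then show ?thesis by (simp add: norm_mult)
qed

text \<open>
  The real part does not depend on \<open>x\<close>, and the imaginary part is monotone in \<open>x\<close> between two
  consecutive integers. Hence the total variation of this function along a monotone sequence
  inside such an interval telescopes.
\<close>

lemma inverse_ee_minus_1:
  assumes "sin (pi * x) \<noteq> 0"
  shows "1 / (ee x - 1) = - 1/2 - \<i> * (of_real (cot (pi * x)) / 2)"
proof -
  have "ee x - 1 = of_real (2 * sin (pi * x)) * (\<i> * cis (pi * x))"
    using cos_double_sin[of "pi * x"] sin_double[of "pi * x"]
    by (simp add: complex_eq_iff power2_eq_square mult.assoc)
  moreover have "(- 1/2 - \<i> * (of_real (cot (pi * x)) / 2)) * of_real (2 * sin (pi * x)) = - (\<i> * cis (- pi * x))"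
    using assms by (simp add: complex_eq_iff cot_def)
  then have "(- 1/2 - \<i> * (of_real (cot (pi * x)) / 2)) * (of_real (2 * sin (pi * x)) * (\<i> * cis (pi * x))) = 1"
    by (simp only: flip: mult.assoc) (simp add: mult.assoc cis_mult mult.left_commute[of _ \<i>])
  ultimately show ?thesis
    by (metis mult_zero_right nonzero_eq_divide_eq zero_neq_one)
qed

lemma cot_diff:
  fixes x y :: real
  assumes "sin x \<noteq> 0" "sin y \<noteq> 0"
  shows "cot x - cot y = sin (y - x) / (sin x * sin y)"
  using assms by (simp add: cot_def sin_diff field_simps)

lemma summation_by_parts_nat:
  fixes E g :: "nat \<Rightarrow> 'a::comm_ring"
  assumes "a < b"
  shows "(\<Sum>m=a..<b. (E (Suc m) - E m) * g m) =
     E b * g (b - 1) - E a * g a - (\<Sum>m=a..<b - 1. E (Suc m) * (g (Suc m) - g m))"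
  using assms
proof (induction b)
  case (Suc b)
  show ?case
  proof (cases "a = b")
    case False
    with Suc have ab: "a < b" by auto
    then obtain c where c: "b = Suc c" by (cases b) auto
    have "a \<le> c" using ab c by simp
    then show ?thesis using Suc.IH[OF ab] by (simp add: c algebra_simps)
  qed (simp add: algebra_simps)
qed simp

text \<open>
  When the phase advances by an amount bounded away from the integers, consecutive terms nearly
  form a geometric progression: \<open>ee (f m)\<close> is \<open>ee (f (m + 1)) - ee (f m)\<close> times
  \<open>1 / (ee (f (m + 1) - f m) - 1)\<close>. Summing by parts leaves two boundary terms and the total
  variation of the second factor, which telescopes by \<open>inverse_ee_minus_1\<close>.
\<close>

lemma Kusmin_Landau:
  fixes f :: "nat \<Rightarrow> real" and \<nu> :: int and \<theta> :: real
  assumes th: "0 < \<theta>"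
    and D: "\<And>m. a \<le> m \<Longrightarrow> m < b \<Longrightarrow> \<nu> + \<theta> \<le> f (Suc m) - f m \<and> f (Suc m) - f m \<le> \<nu> + 1 - \<theta>"
    and mono: "\<And>m. a \<le> m \<Longrightarrow> Suc m < b \<Longrightarrow> f (Suc m) - f m \<le> f (Suc (Suc m)) - f (Suc m)"
  shows "norm (\<Sum>m=a..<b. ee (f m)) \<le> 1 / \<theta>"
proof (cases "a < b")
  case True
  define d where "d m = f (Suc m) - f m - \<nu>" for m
  have d: "\<theta> \<le> d m" "d m \<le> 1 - \<theta>" if "a \<le> m" "m < b" for m
    using D[OF that] by (auto simp: d_def)
  have dmono: "d m \<le> d (Suc m)" if "a \<le> m" "Suc m < b" for m
    using mono[OF that] by (auto simp: d_def)
  have s: "2 * \<theta> \<le> sin (pi * d m)" if "a \<le> m" "m < b" for m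
    using sin_pi_ge[OF th d[OF that]] .
  have s0: "0 < sin (pi * d m)" if "a \<le> m" "m < b" for m
    using s[OF that] th by linarith
  define g where "g m = 1 / (ee (d m) - 1)" for m
  have g_norm: "norm (g m) \<le> 1 / (4 * \<theta>)" if "a \<le> m" "m < b" for m
    using s[OF that] th by (simp add: g_def norm_divide norm_ee_minus_1 frac_le)
  have ee_d: "ee (f (Suc m)) = ee (f m) * ee (d m)" for m
  proof -
    have "2 * pi * f (Suc m) = 2 * pi * f m + 2 * pi * d m + 2 * pi * of_int \<nu>"
      by (simp add: d_def algebra_simps)
    then have "ee (f (Suc m)) = ee (f m) * ee (d m) * cis (2 * pi * of_int \<nu>)"
      by (simp only: cis_mult)
    then show ?thesis by (simp add: cis_multiple_2pi)
  qed
  have telescope: "ee (f m) = (ee (f (Suc m)) - ee (f m)) * g m" if "a \<le> m" "m < b" for m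
  proof -
    have "ee (d m) - 1 \<noteq> 0" using norm_ee_minus_1[of "d m"] s0[OF that] by force
    moreover have "ee (f (Suc m)) - ee (f m) = ee (f m) * (ee (d m) - 1)"
      by (simp only: ee_d right_diff_distrib mult_1_right)
    ultimately show ?thesis by (simp only: g_def) simp
  qed
  have g_diff: "norm (g (Suc m) - g m) = (cot (pi * d m) - cot (pi * d (Suc m))) / 2"
    if "a \<le> m" "Suc m < b" for m
  proof -
    have pos: "0 < sin (pi * d m)" "0 < sin (pi * d (Suc m))" using s0 that by auto
    have "0 \<le> cot (pi * d m) - cot (pi * d (Suc m))"
    proof -
      have "0 \<le> sin (pi * d (Suc m) - pi * d m)"
      proof (rule sin_ge_zero)
        show "0 \<le> pi * d (Suc m) - pi * d m" using dmono[OF that] by (simp add: mult_left_mono)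
        have "d (Suc m) - d m \<le> 1" using d(2)[of "Suc m"] d(1)[of m] that th by linarith
        then have "pi * (d (Suc m) - d m) \<le> pi * 1" by (intro mult_left_mono) auto
        then show "pi * d (Suc m) - pi * d m \<le> pi" by (simp add: right_diff_distrib)
      qed
      then show ?thesis using pos by (subst cot_diff) auto
    qed
    moreover have "g (Suc m) - g m = \<i> * of_real ((cot (pi * d m) - cot (pi * d (Suc m))) / 2)"
    proof -
      have "g (Suc m) = - 1/2 - \<i> * (of_real (cot (pi * d (Suc m))) / 2)"
        unfolding g_def by (rule inverse_ee_minus_1) (use pos in simp)
      moreover have "g m = - 1/2 - \<i> * (of_real (cot (pi * d m)) / 2)"
        unfolding g_def by (rule inverse_ee_minus_1) (use pos in simp)
      ultimately show ?thesis by (simp add: complex_eq_iff diff_divide_distrib)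
    qed
    ultimately show ?thesis by (simp only: norm_mult norm_ii norm_of_real) simp
  qed
  have cot_bound: "\<bar>cot (pi * d m)\<bar> \<le> 1 / (2 * \<theta>)" if "a \<le> m" "m < b" for m
    using s[OF that] th by (simp add: cot_def abs_divide frac_le)
  have tele: "(\<Sum>m=a..<b - 1. cot (pi * d m) - cot (pi * d (Suc m))) = cot (pi * d a) - cot (pi * d (b - 1))"
    using sum_Suc_diff'[of a "b - 1" "\<lambda>m. - cot (pi * d m)"] True by simp
  have "norm (\<Sum>m=a..<b - 1. ee (f (Suc m)) * (g (Suc m) - g m))
      \<le> (\<Sum>m=a..<b - 1. (cot (pi * d m) - cot (pi * d (Suc m))) / 2)"
    by (rule sum_norm_le) (auto simp: norm_mult g_diff)
  also have "\<dots> = (cot (pi * d a) - cot (pi * d (b - 1))) / 2"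
    by (simp only: tele flip: sum_divide_distrib)
  also have "\<dots> \<le> 1 / (2 * \<theta>)"
  proof -
    have "\<bar>cot (pi * d a)\<bar> \<le> 1 / (2 * \<theta>)" "\<bar>cot (pi * d (b - 1))\<bar> \<le> 1 / (2 * \<theta>)"
      using True by (auto intro!: cot_bound simp del: One_nat_def)
    moreover have "(x - y) / 2 \<le> K" if "\<bar>x\<bar> \<le> K" "\<bar>y\<bar> \<le> K" for x y K :: real
      using that by (simp add: abs_le_iff)
    ultimately show ?thesis by blast
  qed
  finally have tv: "norm (\<Sum>m=a..<b - 1. ee (f (Suc m)) * (g (Suc m) - g m)) \<le> 1 / (2 * \<theta>)" .
  have "(\<Sum>m=a..<b. ee (f m)) = (\<Sum>m=a..<b. (ee (f (Suc m)) - ee (f m)) * g m)"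
    by (intro sum.cong refl telescope) auto
  also have "\<dots> = ee (f b) * g (b - 1) - ee (f a) * g a - (\<Sum>m=a..<b - 1. ee (f (Suc m)) * (g (Suc m) - g m))"
    by (rule summation_by_parts_nat[OF True])
  also have "norm \<dots> \<le> norm (g (b - 1)) + norm (g a) + norm (\<Sum>m=a..<b - 1. ee (f (Suc m)) * (g (Suc m) - g m))"
    by (intro order.trans[OF norm_triangle_ineq4] add_mono) (auto simp: norm_mult)
  also have "\<dots> \<le> 1 / (4 * \<theta>) + 1 / (4 * \<theta>) + 1 / (2 * \<theta>)"
    using True by (intro add_mono g_norm tv) auto
  also have "\<dots> = 1 / \<theta>" by (simp add: field_simps)
  finally show ?thesis .
qed (use th in auto)

lemma increments_ge:
  fixes d :: "nat \<Rightarrow> real"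
  assumes "\<And>m. Suc m < M \<Longrightarrow> l \<le> d (Suc m) - d m" and "i \<le> j" "j < M"
  shows "real (j - i) * l \<le> d j - d i"
  using assms(2,3)
proof (induction j rule: dec_induct)
  case (step n)
  then show ?case using assms(1)[of n] by (simp add: Suc_diff_le algebra_simps)
qed simp

lemma increments_mono:
  fixes d :: "nat \<Rightarrow> real"
  assumes "\<And>m. Suc m < M \<Longrightarrow> l \<le> d (Suc m) - d m" "0 \<le> l" and "i \<le> j" "j < M"
  shows "d i \<le> d j"
proof -
  have "0 \<le> real (j - i) * l" using assms(2) by simp
  also have "\<dots> \<le> d j - d i" by (rule increments_ge[of M l d, OF assms(1,3,4)])
  finally show ?thesis by simp
qed

text \<open>
  The indices with first difference in a given range are consecutive, as summation by parts
  requires, and the lower bound \<open>l\<close> on the increments limits their number.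
\<close>

lemma level_set_interval:
  fixes d :: "nat \<Rightarrow> real"
  assumes incr: "\<And>m. Suc m < M \<Longrightarrow> l \<le> d (Suc m) - d m" and l: "0 < l" and xy: "x \<le> y"
  obtains a b where "{m. m < M \<and> x \<le> d m \<and> d m \<le> y} = {a..<b}" "b \<le> M"
    "real (card {m. m < M \<and> x \<le> d m \<and> d m \<le> y}) \<le> (y - x) / l + 1"
proof (cases "{m. m < M \<and> x \<le> d m \<and> d m \<le> y} = {}")
  case True
  show ?thesis by (rule that[of 0 0], unfold True) (use l xy in auto)
next
  case False
  define S where "S = {m. m < M \<and> x \<le> d m \<and> d m \<le> y}"
  have fin: "finite S" and ne: "S \<noteq> {}" using False by (auto simp: S_def)
  have mono: "d i \<le> d j" if "i \<le> j" "j < M" for i j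
    by (rule increments_mono[of M l d, OF incr less_imp_le[OF l] that])
  have MinS: "Min S \<in> S" and MaxS: "Max S \<in> S" using fin ne by auto
  have eq: "S = {Min S..<Suc (Max S)}"
  proof (intro equalityI subsetI)
    fix m assume "m \<in> {Min S..<Suc (Max S)}"
    then have m: "Min S \<le> m" "m \<le> Max S" by auto
    then show "m \<in> S" using MinS MaxS mono[of "Min S" m] mono[of m "Max S"] by (auto simp: S_def)
  qed (use fin in \<open>auto simp: less_Suc_eq_le\<close>)
  have "real (Max S - Min S) * l \<le> d (Max S) - d (Min S)"
    using MaxS MinS fin by (intro increments_ge[of M l d, OF incr]) (auto simp: S_def)
  also have "\<dots> \<le> y - x" using MaxS MinS by (auto simp: S_def)
  finally have "real (Max S - Min S) \<le> (y - x) / l" using l by (simp add: field_simps)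
  moreover have "card S \<le> Max S - Min S + 1" using arg_cong[OF eq, of card] by auto
  ultimately have "real (card S) \<le> (y - x) / l + 1" by linarith
  moreover have "Suc (Max S) \<le> M" using MaxS by (auto simp: S_def)
  ultimately show ?thesis using eq by (intro that) (auto simp: S_def)
qed

lemma norm_sum_ee_le_card: "norm (\<Sum>m\<in>A. ee (f m)) \<le> real (card A)"
  by (rule order.trans[OF sum_norm_le[where g="\<lambda>_. 1"]]) auto

text \<open>
  The first differences \<open>d m\<close> of the phase increase by at least \<open>l\<close> and at most \<open>\<alpha> * l\<close> at each step,
  so they cover about \<open>\<alpha> * l * M\<close> unit intervals. Within one unit interval at most about \<open>\<theta> / l\<close>
  indices have \<open>d m\<close> within \<open>\<theta>\<close> of an integer, and they are counted trivially; the others contribute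
  \<open>1 / \<theta>\<close> by \<open>Kusmin_Landau\<close>. The two contributions balance at \<open>\<theta> = sqrt l\<close>.
\<close>

lemma van_der_Corput_second_difference:
  fixes f :: "nat \<Rightarrow> real"
  assumes l: "0 < l"
    and D2: "\<And>m. Suc (Suc m) < M \<Longrightarrow> l \<le> f (Suc (Suc m)) - 2 * f (Suc m) + f m \<and>
                  f (Suc (Suc m)) - 2 * f (Suc m) + f m \<le> \<alpha> * l"
    and \<alpha>: "0 \<le> \<alpha>"
  shows "norm (\<Sum>m<M. ee (f m)) \<le> 4 * \<alpha> * real M * sqrt l + 2 * real M * sqrt l + 9 / sqrt l"
proof (cases "l \<le> 1 / 4")
  case False
  \<comment> \<open>For such \<open>l\<close> the claimed bound exceeds the number of terms.\<close>
  then have "1 / 2 \<le> sqrt l" by (intro real_le_rsqrt) (simp add: power2_eq_square)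
  have "norm (\<Sum>m<M. ee (f m)) \<le> real M"
    using norm_sum_ee_le_card[of f "{..<M}"] by simp
  also have "\<dots> \<le> 2 * real M * sqrt l"
    using mult_left_mono[OF \<open>1 / 2 \<le> sqrt l\<close>, of "2 * real M"] by simp
  also have "\<dots> \<le> 4 * \<alpha> * real M * sqrt l + 2 * real M * sqrt l + 9 / sqrt l"
    using l \<alpha> by simp
  finally show ?thesis .
next
  case True
  define \<theta> where "\<theta> = sqrt l"
  have "sqrt l \<le> sqrt ((1 / 2)\<^sup>2)"
    using True by (intro real_sqrt_le_mono) (simp add: power2_eq_square)
  then have \<theta>: "0 < \<theta>" "\<theta> \<le> 1 / 2" "\<theta> * \<theta> = l"
    using l by (auto simp: \<theta>_def)
  have inv\<theta>: "2 \<le> 1 / \<theta>" using \<theta> by (simp add: field_simps)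
  show ?thesis
  proof (cases M)
    case (Suc N)
    define d where "d m = f (Suc m) - f m" for m
    have incr: "l \<le> d (Suc m) - d m \<and> d (Suc m) - d m \<le> \<alpha> * l" if "Suc m < N" for m
      using D2[of m] that Suc by (simp add: d_def)
    \<comment> \<open>Each end of the unit interval contributes at most \<open>1 / \<theta> + 1\<close> and the middle \<open>1 / \<theta>\<close>, where \<open>1 \<le> 1 / (2 * \<theta>)\<close>.\<close>
    have piece: "norm (\<Sum>m\<in>{m\<in>{..<N}. \<lfloor>d m\<rfloor> = \<nu>}. ee (f m)) \<le> 4 / \<theta>" for \<nu>
    proof -
      let ?L = "\<lambda>x y. {m. m < N \<and> x \<le> d m \<and> d m \<le> y}"
      define A where "A = {m\<in>{..<N}. \<lfloor>d m\<rfloor> = \<nu> \<and> d m < \<nu> + \<theta>}"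
      define B where "B = ?L (\<nu> + \<theta>) (\<nu> + 1 - \<theta>)"
      define C where "C = {m\<in>{..<N}. \<lfloor>d m\<rfloor> = \<nu> \<and> \<nu> + 1 - \<theta> < d m}"
      have fin: "finite A" "finite B" "finite C" by (auto simp: A_def B_def C_def)
      have split: "{m\<in>{..<N}. \<lfloor>d m\<rfloor> = \<nu>} = A \<union> B \<union> C"
        using \<theta> by (auto simp: A_def B_def C_def floor_eq_iff)
      have "norm (\<Sum>m\<in>A. ee (f m)) \<le> card A" by (rule norm_sum_ee_le_card)
      also have "card A \<le> card (?L \<nu> (\<nu> + \<theta>))"
        by (intro card_mono) (auto simp: A_def floor_eq_iff)
      also have "real (card (?L \<nu> (\<nu> + \<theta>))) \<le> \<theta> / l + 1"
        by (rule level_set_interval[of N l d \<nu> "\<nu> + \<theta>"]) (use incr l \<theta> in auto)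
      finally have A: "norm (\<Sum>m\<in>A. ee (f m)) \<le> \<theta> / l + 1" by simp
      have "norm (\<Sum>m\<in>C. ee (f m)) \<le> card C" by (rule norm_sum_ee_le_card)
      also have "card C \<le> card (?L (\<nu> + 1 - \<theta>) (\<nu> + 1))"
        by (intro card_mono) (auto simp: C_def floor_eq_iff)
      also have "real (card (?L (\<nu> + 1 - \<theta>) (\<nu> + 1))) \<le> \<theta> / l + 1"
        by (rule level_set_interval[of N l d "\<nu> + 1 - \<theta>" "\<nu> + 1"]) (use incr l \<theta> in auto)
      finally have C: "norm (\<Sum>m\<in>C. ee (f m)) \<le> \<theta> / l + 1" by simp
      obtain a b where ab: "B = {a..<b}" "b \<le> N"
        unfolding B_def
        by (rule level_set_interval[of N l d "\<nu> + \<theta>" "\<nu> + 1 - \<theta>"]) (use incr l \<theta> in auto)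
      have B: "norm (\<Sum>m\<in>B. ee (f m)) \<le> 1 / \<theta>"
        unfolding ab(1)
      proof (rule Kusmin_Landau[OF \<theta>(1)])
        fix m assume "a \<le> m" "m < b"
        then have "m \<in> B" by (simp add: ab)
        then show "\<nu> + \<theta> \<le> f (Suc m) - f m \<and> f (Suc m) - f m \<le> \<nu> + 1 - \<theta>"
          by (simp add: B_def d_def)
      next
        fix m assume "a \<le> m" "Suc m < b"
        then show "f (Suc m) - f m \<le> f (Suc (Suc m)) - f (Suc m)"
          using incr[of m] ab l by (simp add: d_def)
      qed
      have "(\<Sum>m\<in>{m\<in>{..<N}. \<lfloor>d m\<rfloor> = \<nu>}. ee (f m)) =
        (\<Sum>m\<in>A. ee (f m)) + (\<Sum>m\<in>B. ee (f m)) + (\<Sum>m\<in>C. ee (f m))"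
        unfolding split using fin \<theta>
        by (subst sum.union_disjoint, simp, simp, force simp: A_def B_def C_def)
           (subst sum.union_disjoint, auto simp: A_def B_def C_def)
      also have "norm \<dots> \<le> (\<theta> / l + 1) + 1 / \<theta> + (\<theta> / l + 1)"
        by (intro norm_triangle_le add_mono A B C)
      also have "\<theta> / l = 1 / \<theta>" using \<theta> by (simp flip: \<theta>(3))
      also have "(1 / \<theta> + 1) + 1 / \<theta> + (1 / \<theta> + 1) \<le> 4 / \<theta>" using inv\<theta> by simp
      finally show ?thesis .
    qed
    \<comment> \<open>The last term is left out because it has no first difference.\<close>
    have tot: "norm (\<Sum>m<N. ee (f m)) \<le> (\<alpha> * l * real M + 2) * (4 / \<theta>)"
    proof (cases "N = 0")
      case True
      then show ?thesis using \<alpha> l \<theta> by simp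
    next
      case False
      let ?T = "{\<lfloor>d 0\<rfloor>..\<lfloor>d (N - 1)\<rfloor>}"
      have mono: "d i \<le> d j" if "i \<le> j" "j < N" for i j
        using increments_mono[of N l d, OF _ less_imp_le[OF l] that] incr by blast
      have "(\<lambda>m. \<lfloor>d m\<rfloor>) ` {..<N} \<subseteq> ?T" by (auto intro!: floor_mono mono)
      then have "(\<Sum>m<N. ee (f m)) = (\<Sum>\<nu>\<in>?T. \<Sum>m\<in>{m\<in>{..<N}. \<lfloor>d m\<rfloor> = \<nu>}. ee (f m))"
        by (intro sum.group[symmetric]) auto
      also have "norm \<dots> \<le> (\<Sum>\<nu>\<in>?T. 4 / \<theta>)" by (rule sum_norm_le) (use piece in auto)
      also have "\<dots> = real (card ?T) * (4 / \<theta>)" by simp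
      also have "\<dots> \<le> (\<alpha> * l * real M + 2) * (4 / \<theta>)"
      proof (rule mult_right_mono)
        have "d (N - 1) - d 0 \<le> real (N - 1) * (\<alpha> * l)"
          using increments_ge[of N "- (\<alpha> * l)" "\<lambda>m. - d m" 0 "N - 1"] incr False by force
        also have "\<dots> \<le> real M * (\<alpha> * l)" using \<alpha> l Suc by (intro mult_right_mono) auto
        finally have "d (N - 1) - d 0 \<le> \<alpha> * l * real M" by (simp add: mult_ac)
        moreover have "\<lfloor>d 0\<rfloor> \<le> \<lfloor>d (N - 1)\<rfloor>" using False by (intro floor_mono mono) auto
        ultimately show "real (card ?T) \<le> \<alpha> * l * real M + 2" by simp linarith
      qed (use \<theta> in auto)
      finally show ?thesis .
    qed
    have "norm (\<Sum>m<M. ee (f m)) \<le> norm (\<Sum>m<N. ee (f m)) + norm (ee (f N))"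
      unfolding Suc sum.lessThan_Suc by (rule norm_triangle_ineq)
    also have "\<dots> \<le> (\<alpha> * l * real M + 2) * (4 / \<theta>) + 1 / \<theta>" using tot inv\<theta> by simp
    also have "\<dots> = 4 * \<alpha> * real M * \<theta> + 9 / \<theta>" using \<theta>(1) by (simp add: field_simps flip: \<theta>(3))
    also have "\<dots> \<le> 4 * \<alpha> * real M * \<theta> + 2 * real M * \<theta> + 9 / \<theta>" using \<theta>(1) by simp
    finally show ?thesis unfolding \<theta>_def .
  qed (use l in simp)
qed

section \<open>The sawtooth function and its averages\<close>

definition sawtooth :: "real \<Rightarrow> real" where "sawtooth y = frac y - 1/2"

text \<open>
  Up to a constant, the periodic second Bernoulli function; it is a primitive of \<open>2 * sawtooth\<close>.
\<close>

definition periodic_quad :: "real \<Rightarrow> real" where "periodic_quad y = (frac y)\<^sup>2 - frac y"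

lemma frac_add_small:
  assumes "0 < \<delta>" "\<delta> \<le> (1::real)"
  shows "frac (y + \<delta>) = (if frac y + \<delta> < 1 then frac y + \<delta> else frac y + \<delta> - 1)"
proof -
  have "\<lfloor>y + \<delta>\<rfloor> = (if frac y + \<delta> < 1 then \<lfloor>y\<rfloor> else \<lfloor>y\<rfloor> + 1)"
    using assms frac_ge_0[of y] frac_lt_1[of y]
    by (cases "frac y + \<delta> < 1") (simp_all add: floor_eq_iff frac_def, linarith+)
  then show ?thesis by (auto simp: frac_def)
qed

text \<open>
  The quotient is the mean of the sawtooth over \<open>[y, y + \<delta>]\<close>. The sawtooth rises with slope 1 and only
  jumps downwards, so this mean exceeds the value at the left end by at most \<open>\<delta>\<close>, whether or not
  there is a jump in between. The next lemma is the same observation at the right end. Thus each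
  value of the discontinuous sawtooth is enclosed by averages, with an error \<open>\<delta>\<close> uniform in \<open>y\<close>.
\<close>

lemma sawtooth_ge:
  assumes "0 < \<delta>" "\<delta> \<le> 1"
  shows "(periodic_quad (y + \<delta>) - periodic_quad y) / (2 * \<delta>) - \<delta> \<le> sawtooth y"
proof -
  have "periodic_quad (y + \<delta>) - periodic_quad y \<le> 2 * frac y * \<delta> + \<delta> * \<delta> - \<delta>"
    unfolding periodic_quad_def frac_add_small[OF assms]
    using assms by (simp add: power2_eq_square algebra_simps)
  then have "periodic_quad (y + \<delta>) - periodic_quad y \<le> (sawtooth y + \<delta>) * (2 * \<delta>)"
    using mult_pos_pos[OF assms(1) assms(1)] unfolding sawtooth_def by (simp add: algebra_simps)
  then show ?thesis using assms by (simp add: pos_divide_le_eq diff_le_eq)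
qed

lemma sawtooth_le:
  assumes "0 < \<delta>" "\<delta> \<le> 1"
  shows "sawtooth y \<le> (periodic_quad y - periodic_quad (y - \<delta>)) / (2 * \<delta>) + \<delta>"
proof -
  define z where "z = y - \<delta>"
  have y: "y = z + \<delta>" by (simp add: z_def)
  have "0 \<le> \<delta> * frac z" "\<delta> * frac z \<le> frac z" using assms by (auto simp: mult_left_le_one_le)
  then have "sawtooth y * (2 * \<delta>) \<le> periodic_quad y - periodic_quad z + \<delta> * (2 * \<delta>)"
    using mult_pos_pos[OF assms(1) assms(1)] frac_lt_1[of z] unfolding y periodic_quad_def sawtooth_def frac_add_small[OF assms]
    by (simp add: power2_eq_square algebra_simps)
  then have "sawtooth y \<le> (periodic_quad y - periodic_quad z + \<delta> * (2 * \<delta>)) / (2 * \<delta>)"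
    using assms by (simp add: pos_le_divide_eq)
  also have "\<dots> = (periodic_quad y - periodic_quad z) / (2 * \<delta>) + \<delta>"
    using assms by (simp add: add_divide_distrib)
  finally show ?thesis by (simp add: z_def)
qed

lemma dilog_cos_frac: "dilog_cos 1 (frac y) = dilog_cos 1 y"
proof -
  have "cos (2 * pi * real (Suc n) * frac y) = cos (2 * pi * real (Suc n) * y)" for n
  proof -
    have "2 * pi * real (Suc n) * frac y = 2 * pi * real (Suc n) * y - 2 * pi * of_int (int (Suc n) * \<lfloor>y\<rfloor>)"
      by (simp add: frac_def algebra_simps)
    then show ?thesis by (simp only: cos_diff cos_int_2pin sin_int_2pin mult_zero_right mult_1_right add_0_right)
  qed
  then show ?thesis by (simp only: dilog_cos_def)
qed

lemma periodic_quad_fourier: "periodic_quad y = (dilog_cos 1 y - dilog_cos 1 0) / pi\<^sup>2"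
  using dilog_cos_1[of "frac y"] frac_lt_1[of y] by (simp add: periodic_quad_def dilog_cos_frac)

lemma dilog_cos_1_sums: "(\<lambda>n. cos (2 * pi * (real (Suc n) * x)) / real (Suc n) ^ 2) sums dilog_cos 1 x"
proof -
  have "summable (\<lambda>n. 1 ^ Suc n * cos (2 * pi * real (Suc n) * x) / real (Suc n) ^ 2)"
    by (rule summable_comparison_test'[OF summable_inverse_Suc_squares dilog_cos_bound]) auto
  then show ?thesis
    using summable_sums unfolding dilog_cos_def by (simp add: mult.assoc)
qed

section \<open>Sums of the sawtooth function\<close>

text \<open>
  Makes the sums of \<open>j powr (- 1 / 2)\<close> and of \<open>j powr (- 3 / 2)\<close> telescope in \<open>weighted_sum_le\<close>.
\<close>

lemma sqrt_Suc_diff_ge: "1 / sqrt (real (Suc n)) \<le> 2 * (sqrt (real (Suc n)) - sqrt (real n))"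
proof -
  define a b where "a = sqrt (real (Suc n))" and "b = sqrt (real n)"
  have ab: "0 < a" "b \<le> a" by (auto simp: a_def b_def)
  have "1 = (a - b) * (a + b)" by (simp add: a_def b_def algebra_simps)
  also have "\<dots> \<le> (a - b) * (2 * a)" using ab by (intro mult_left_mono) auto
  finally have "1 \<le> (2 * (a - b)) * a" by (simp only: mult_ac)
  then show ?thesis using ab unfolding a_def[symmetric] b_def[symmetric]
    by (simp only: pos_divide_le_eq)
qed

text \<open>
  Averaging the sawtooth over length \<open>1 / J\<close> damps the frequencies beyond \<open>J\<close>. Together with the
  growth \<open>sqrt j\<close> of the exponential sums, frequency \<open>j\<close> has weight \<open>j powr (- 1 / 2) / J\<close> for
  \<open>j \<le> J\<close> and \<open>j powr (- 3 / 2)\<close> beyond, and both ranges contribute the order \<open>1 / sqrt J\<close>.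
\<close>

lemma weighted_sum_le:
  assumes J: "0 < J"
  shows "(\<Sum>i<n. min 1 (real (Suc i) / real J) / (real (Suc i) * sqrt (real (Suc i)))) \<le> 4 / sqrt (real J)"
proof -
  let ?w = "\<lambda>i. min 1 (real (Suc i) / real J) / (real (Suc i) * sqrt (real (Suc i)))"
  have small: "(\<Sum>i<n. ?w i) \<le> 2 * sqrt (real n) / real J" if "n \<le> J" for n
    using that
  proof (induction n)
    case (Suc n)
    have "?w n = (1 / sqrt (real (Suc n))) / real J"
      using Suc.prems J by (simp add: min_absorb2 field_simps del: of_nat_Suc)
    also have "\<dots> \<le> 2 * (sqrt (real (Suc n)) - sqrt (real n)) / real J"
      by (intro divide_right_mono sqrt_Suc_diff_ge) auto
    finally have "?w n \<le> 2 * sqrt (real (Suc n)) / real J - 2 * sqrt (real n) / real J"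
      by (simp add: diff_divide_distrib right_diff_distrib)
    moreover have "(\<Sum>i<n. ?w i) \<le> 2 * sqrt (real n) / real J" using Suc by simp
    ultimately show ?case unfolding sum.lessThan_Suc by linarith
  qed simp
  have large: "(\<Sum>i<n. ?w i) \<le> 4 / sqrt (real J) - 2 / sqrt (real n)" if "J \<le> n" for n
    using that
  proof (induction n rule: dec_induct)
    case base
    have "2 * sqrt (real J) / real J = 4 / sqrt (real J) - 2 / sqrt (real J)"
      using J by (simp add: field_simps)
    then show ?case using small[of J] by simp
  next
    case (step n)
    have n: "0 < real n" using step J by simp
    have "?w n \<le> 1 / (real (Suc n) * sqrt (real (Suc n)))" by (intro divide_right_mono) auto
    also have "\<dots> = (1 / sqrt (real (Suc n))) / (sqrt (real (Suc n)) * sqrt (real (Suc n)))"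
      by (simp add: field_simps del: of_nat_Suc)
    also have "\<dots> \<le> (2 * (sqrt (real (Suc n)) - sqrt (real n))) / (sqrt (real (Suc n)) * sqrt (real n))"
      using n by (intro frac_le sqrt_Suc_diff_ge mult_left_mono) auto
    also have "\<dots> = 2 / sqrt (real n) - 2 / sqrt (real (Suc n))"
      using n by (simp add: field_simps del: of_nat_Suc)
    finally show ?case using step.IH unfolding sum.lessThan_Suc by linarith
  qed
  show ?thesis
  proof (cases "n \<le> J")
    case True
    have "2 * sqrt (real n) / real J \<le> 2 * sqrt (real J) / real J"
      using True by (intro divide_right_mono) auto
    also have "\<dots> \<le> 4 / sqrt (real J)" using J by (simp add: field_simps)
    finally show ?thesis using small[OF True] by linarith
  next
    case False
    then show ?thesis using large[of n] by (smt (verit) divide_nonneg_nonneg nat_le_linear of_nat_0_le_iff real_sqrt_ge_zero)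
  qed
qed

text \<open>
  Expand in the absolutely convergent Fourier series and exchange the two sums. At frequency \<open>j\<close> the
  shift by \<open>1 / J\<close> gives the factor \<open>ee (j / J) - 1\<close>, of size at most \<open>2 * pi * min 1 (j / J)\<close>.
\<close>

lemma sum_periodic_quad_diff_le:
  fixes y :: "nat \<Rightarrow> real"
  assumes J: "0 < J" and A: "0 \<le> A"
    and S: "\<And>j. 0 < j \<Longrightarrow> norm (\<Sum>m<M. ee (real j * y m)) \<le> A * sqrt (real j)"
  shows "\<bar>\<Sum>m<M. periodic_quad (y m + 1 / real J) - periodic_quad (y m)\<bar> \<le> 8 * A / sqrt (real J)"
proof -
  define \<delta> where "\<delta> = 1 / real J"
  define c where "c n = (\<Sum>m<M. cos (2 * pi * (real (Suc n) * (y m + \<delta>))) / real (Suc n) ^ 2 -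
      cos (2 * pi * (real (Suc n) * y m)) / real (Suc n) ^ 2)" for n
  have c_sums: "c sums (\<Sum>m<M. dilog_cos 1 (y m + \<delta>) - dilog_cos 1 (y m))"
    unfolding c_def by (intro sums_sum sums_diff dilog_cos_1_sums)
  let ?w = "\<lambda>i. min 1 (real (Suc i) / real J) / (real (Suc i) * sqrt (real (Suc i)))"
  have c_le: "\<bar>c n\<bar> \<le> 2 * pi * A * ?w n" for n
  proof -
    define j where "j = real (Suc n)"
    have j: "0 < j" by (simp add: j_def)
    have "c n = Re ((ee (j * \<delta>) - 1) * (\<Sum>m<M. ee (j * y m))) / j ^ 2"
      unfolding c_def j_def[symmetric] sum_subtractf[symmetric] diff_divide_distrib[symmetric] sum_divide_distrib[symmetric]
      by (simp add: sum_distrib_left sum_subtractf left_diff_distrib cis_mult distrib_left add.commute)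
    then have "\<bar>c n\<bar> = \<bar>Re ((ee (j * \<delta>) - 1) * (\<Sum>m<M. ee (j * y m)))\<bar> / j ^ 2"
      by (simp add: abs_divide)
    also have "\<dots> \<le> norm ((ee (j * \<delta>) - 1) * (\<Sum>m<M. ee (j * y m))) / j ^ 2"
      by (intro divide_right_mono abs_Re_le_cmod) auto
    also have "\<dots> \<le> (2 * pi * min 1 (j / real J)) * (A * sqrt j) / j ^ 2"
      unfolding norm_mult
    proof (intro divide_right_mono mult_mono)
      have "\<bar>sin (pi * (j * \<delta>))\<bar> \<le> pi * 1"
        using pi_ge_two abs_sin_le_one[of "pi * (j * \<delta>)"] by linarith
      moreover have "\<bar>sin (pi * (j * \<delta>))\<bar> \<le> pi * (j / real J)"
        using abs_sin_x_le_abs_x[of "pi * (j * \<delta>)"] j by (simp add: \<delta>_def abs_mult)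
      ultimately show "norm (ee (j * \<delta>) - 1) \<le> 2 * pi * min 1 (j / real J)"
        unfolding norm_ee_minus_1 by (simp add: min_def)
      show "norm (\<Sum>m<M. ee (j * y m)) \<le> A * sqrt j"
        unfolding j_def by (rule S) simp
    qed (use j in auto)
    also have "\<dots> = 2 * pi * A * ?w n"
      using j unfolding j_def[symmetric] by (simp add: power2_eq_square real_div_sqrt divide_simps mult_ac)
    finally show ?thesis .
  qed
  have "\<bar>\<Sum>i<n. c i\<bar> \<le> 2 * pi * A * (4 / sqrt (real J))" for n
  proof -
    have "\<bar>\<Sum>i<n. c i\<bar> \<le> (\<Sum>i<n. 2 * pi * A * ?w i)"
      by (rule order.trans[OF sum_abs]) (intro sum_mono c_le)
    also have "\<dots> = 2 * pi * A * (\<Sum>i<n. ?w i)" by (simp only: sum_distrib_left)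
    also have "\<dots> \<le> 2 * pi * A * (4 / sqrt (real J))"
      by (intro mult_left_mono weighted_sum_le J) (use A in auto)
    finally show ?thesis .
  qed
  moreover have "(\<lambda>n. \<bar>\<Sum>i<n. c i\<bar>) \<longlonglongrightarrow> \<bar>\<Sum>m<M. dilog_cos 1 (y m + \<delta>) - dilog_cos 1 (y m)\<bar>"
    using c_sums unfolding sums_def by (rule tendsto_rabs)
  ultimately have bound: "\<bar>\<Sum>m<M. dilog_cos 1 (y m + \<delta>) - dilog_cos 1 (y m)\<bar> \<le> 2 * pi * A * (4 / sqrt (real J))"
    by (intro LIMSEQ_le_const2) auto
  have "(\<Sum>m<M. periodic_quad (y m + \<delta>) - periodic_quad (y m)) =
     (\<Sum>m<M. dilog_cos 1 (y m + \<delta>) - dilog_cos 1 (y m)) / pi\<^sup>2"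
    by (simp add: periodic_quad_fourier sum_divide_distrib flip: diff_divide_distrib)
  then have "\<bar>\<Sum>m<M. periodic_quad (y m + \<delta>) - periodic_quad (y m)\<bar> \<le> 2 * pi * A * (4 / sqrt (real J)) / pi\<^sup>2"
    using divide_right_mono[OF bound, of "pi\<^sup>2"] by (simp only: abs_divide) simp
  also have "\<dots> = (8 * A / sqrt (real J)) / pi" by (simp add: power2_eq_square)
  also have "\<dots> \<le> (8 * A / sqrt (real J)) / 1"
    using pi_ge_two A by (intro divide_left_mono) auto
  finally show ?thesis by (simp add: \<delta>_def)
qed

text \<open>
  An inequality of Erdos-Turan type: the first term is the error of replacing the sawtooth by its
  average over length \<open>1 / J\<close>, the second bounds the sum of the averages.
\<close>

lemma sum_sawtooth_le:
  fixes y :: "nat \<Rightarrow> real"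
  assumes J: "0 < J" and A: "0 \<le> A"
    and S: "\<And>j. 0 < j \<Longrightarrow> norm (\<Sum>m<M. ee (real j * y m)) \<le> A * sqrt (real j)"
  shows "\<bar>\<Sum>m<M. sawtooth (y m)\<bar> \<le> real M / real J + 4 * A * sqrt (real J)"
proof -
  define \<delta> where "\<delta> = 1 / real J"
  have \<delta>: "0 < \<delta>" "\<delta> \<le> 1" using J by (auto simp: \<delta>_def)
  have err: "8 * A / sqrt (real J) / (2 * \<delta>) = 4 * A * sqrt (real J)"
    using J by (simp add: \<delta>_def field_simps)
  have "(\<Sum>m<M. (periodic_quad (y m + \<delta>) - periodic_quad (y m)) / (2 * \<delta>) - \<delta>) \<le> (\<Sum>m<M. sawtooth (y m))"
    by (intro sum_mono sawtooth_ge \<delta>)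
  moreover have "(\<Sum>m<M. (periodic_quad (y m + \<delta>) - periodic_quad (y m)) / (2 * \<delta>) - \<delta>) =
      (\<Sum>m<M. periodic_quad (y m + \<delta>) - periodic_quad (y m)) / (2 * \<delta>) - real M * \<delta>"
    by (simp only: sum_subtractf sum_divide_distrib) (simp add: sum_subtractf diff_divide_distrib sum_divide_distrib)
  moreover have "- (4 * A * sqrt (real J)) \<le> (\<Sum>m<M. periodic_quad (y m + \<delta>) - periodic_quad (y m)) / (2 * \<delta>)"
  proof -
    have "- (8 * A / sqrt (real J)) \<le> (\<Sum>m<M. periodic_quad (y m + \<delta>) - periodic_quad (y m))"
      using sum_periodic_quad_diff_le[OF J A S] unfolding \<delta>_def by linarith
    from divide_right_mono[OF this, of "2 * \<delta>"] show ?thesis using \<delta> err by simp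
  qed
  ultimately have lower: "- (real M * \<delta> + 4 * A * sqrt (real J)) \<le> (\<Sum>m<M. sawtooth (y m))" by linarith
  have S': "norm (\<Sum>m<M. ee (real j * (y m - \<delta>))) \<le> A * sqrt (real j)" if "0 < j" for j
  proof -
    have "(\<Sum>m<M. ee (real j * (y m - \<delta>))) = (\<Sum>m<M. ee (real j * y m)) * ee (- (real j * \<delta>))"
      by (simp only: sum_distrib_right cis_mult) (simp add: algebra_simps)
    then show ?thesis using S[OF that] by (simp add: norm_mult)
  qed
  have "(\<Sum>m<M. sawtooth (y m)) \<le> (\<Sum>m<M. (periodic_quad (y m) - periodic_quad (y m - \<delta>)) / (2 * \<delta>) + \<delta>)"
    by (intro sum_mono sawtooth_le \<delta>)
  moreover have "(\<Sum>m<M. (periodic_quad (y m) - periodic_quad (y m - \<delta>)) / (2 * \<delta>) + \<delta>) =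
      (\<Sum>m<M. periodic_quad (y m) - periodic_quad (y m - \<delta>)) / (2 * \<delta>) + real M * \<delta>"
    by (simp only: sum.distrib sum_divide_distrib) simp
  moreover have "(\<Sum>m<M. periodic_quad (y m) - periodic_quad (y m - \<delta>)) / (2 * \<delta>) \<le> 4 * A * sqrt (real J)"
  proof -
    have "(\<Sum>m<M. periodic_quad (y m) - periodic_quad (y m - \<delta>)) \<le> 8 * A / sqrt (real J)"
      using sum_periodic_quad_diff_le[OF J A S'] unfolding \<delta>_def by simp
    from divide_right_mono[OF this, of "2 * \<delta>"] show ?thesis using \<delta> err by simp
  qed
  ultimately have "(\<Sum>m<M. sawtooth (y m)) \<le> real M * \<delta> + 4 * A * sqrt (real J)" by linarith
  then show ?thesis using lower by (simp add: \<delta>_def abs_le_iff)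
qed

text \<open>
  With second differences of size \<open>\<epsilon>\<close> and \<open>M\<close> of size \<open>1 / \<epsilon>\<close>, the van der Corput bound at frequency \<open>j\<close>
  is a multiple of \<open>sqrt (j / \<epsilon>)\<close>, so \<open>sum_sawtooth_le\<close> gives \<open>1 / (\<epsilon> * J) + sqrt (J / \<epsilon>)\<close>
  up to constants. The optimal cut-off \<open>J\<close> is \<open>\<epsilon> powr (- 1 / 3)\<close>.
\<close>

lemma sum_sawtooth_curved_le:
  fixes c C K :: real
  assumes c: "0 < c" and C: "0 \<le> C" and K: "0 \<le> K"
  obtains B where "0 \<le> B"
    "\<And>\<epsilon> M f a. \<lbrakk>0 < \<epsilon>; \<epsilon> \<le> 1; real M \<le> K / \<epsilon>;
      \<And>m. Suc (Suc m) < M \<Longrightarrow> c * \<epsilon> \<le> f (Suc (Suc m)) - 2 * f (Suc m) + f m \<and>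
                  f (Suc (Suc m)) - 2 * f (Suc m) + f m \<le> C * \<epsilon>\<rbrakk>
     \<Longrightarrow> \<bar>\<Sum>m<M. sawtooth (f m - a)\<bar> \<le> B * \<epsilon> powr (- 2 / 3)"
proof -
  define A\<^sub>0 where "A\<^sub>0 = (4 * (C / c) + 2) * K * sqrt c + 9 / sqrt c"
  have A0: "0 \<le> A\<^sub>0" using c C K by (simp add: A\<^sub>0_def)
  show ?thesis
  proof (rule that[of "K + 8 * A\<^sub>0"])
    fix \<epsilon> :: real and M and f :: "nat \<Rightarrow> real" and a
    assume \<epsilon>: "0 < \<epsilon>" "\<epsilon> \<le> 1" and M: "real M \<le> K / \<epsilon>"
      and D2: "\<And>m. Suc (Suc m) < M \<Longrightarrow> c * \<epsilon> \<le> f (Suc (Suc m)) - 2 * f (Suc m) + f m \<and>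
                  f (Suc (Suc m)) - 2 * f (Suc m) + f m \<le> C * \<epsilon>"
    \<comment> \<open>All powers of \<open>\<epsilon>\<close> that occur are integral powers of \<open>t\<close>.\<close>
    define t where "t = \<epsilon> powr (- 1 / 6)"
    have t0: "0 < t" using \<epsilon> by (simp add: t_def)
    have tpow: "t ^ n = \<epsilon> powr (- real n / 6)" for n
      using \<epsilon> by (simp add: t_def powr_power)
    have t4: "\<epsilon> powr (- 2 / 3) = t ^ 4" by (simp add: tpow)
    have t6: "1 / \<epsilon> = t ^ 6" using \<epsilon> by (simp add: tpow powr_minus_divide)
    have t3: "1 / sqrt \<epsilon> = t ^ 3" using \<epsilon> by (simp add: tpow powr_minus_divide powr_half_sqrt)
    have t1: "1 \<le> t"
      using \<epsilon> by (simp add: t_def powr_minus_divide powr_le1)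
    have S: "norm (\<Sum>m<M. ee (real j * (f m - a))) \<le> (A\<^sub>0 / sqrt \<epsilon>) * sqrt (real j)" if j: "0 < j" for j :: nat
    proof -
      let ?y = "\<lambda>m. real j * (f m - a)"
      let ?l = "real j * (c * \<epsilon>)"
      have l: "0 < ?l" using j c \<epsilon> by simp
      have "norm (\<Sum>m<M. ee (?y m)) \<le> 4 * (C / c) * real M * sqrt ?l + 2 * real M * sqrt ?l + 9 / sqrt ?l"
      proof (rule van_der_Corput_second_difference[OF l])
        fix m assume m: "Suc (Suc m) < M"
        have eq: "?y (Suc (Suc m)) - 2 * ?y (Suc m) + ?y m = real j * (f (Suc (Suc m)) - 2 * f (Suc m) + f m)"
          by (simp add: algebra_simps)
        have "C / c * ?l = real j * (C * \<epsilon>)" using c by simp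
        then show "?l \<le> ?y (Suc (Suc m)) - 2 * ?y (Suc m) + ?y m \<and>
            ?y (Suc (Suc m)) - 2 * ?y (Suc m) + ?y m \<le> C / c * ?l"
          unfolding eq using D2[OF m] j by (simp add: mult_left_mono)
      qed (use c C in simp)
      also have "\<dots> = (4 * (C / c) + 2) * sqrt c * (real M * sqrt \<epsilon>) * sqrt (real j) + 9 / sqrt ?l"
        by (simp add: real_sqrt_mult algebra_simps)
      also have "\<dots> \<le> (4 * (C / c) + 2) * sqrt c * (K / sqrt \<epsilon>) * sqrt (real j) + 9 / (sqrt c * sqrt \<epsilon>) * sqrt (real j)"
      proof (intro add_mono mult_right_mono mult_left_mono)
        have "real M * sqrt \<epsilon> \<le> K / \<epsilon> * sqrt \<epsilon>" using M \<epsilon> by (intro mult_right_mono) auto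
        also have "\<dots> = K / sqrt \<epsilon>" using \<epsilon> by (simp add: field_simps)
        finally show "real M * sqrt \<epsilon> \<le> K / sqrt \<epsilon>" .
        have "9 / sqrt ?l = 9 / (sqrt c * sqrt \<epsilon>) / sqrt (real j)"
          by (simp add: real_sqrt_mult)
        also have "\<dots> \<le> 9 / (sqrt c * sqrt \<epsilon>) * sqrt (real j)"
        proof -
          have "1 / sqrt (real j) \<le> sqrt (real j)" using j by (simp add: divide_le_eq)
          from mult_left_mono[OF this, of "9 / (sqrt c * sqrt \<epsilon>)"] show ?thesis using c \<epsilon> by simp
        qed
        finally show "9 / sqrt ?l \<le> 9 / (sqrt c * sqrt \<epsilon>) * sqrt (real j)" .
      qed (use c C in auto)
      also have "\<dots> = (A\<^sub>0 / sqrt \<epsilon>) * sqrt (real j)"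
        unfolding A\<^sub>0_def add_divide_distrib distrib_right[of _ _ "sqrt (real j)"] by (simp add: mult_ac)
      finally show ?thesis .
    qed
    define J where "J = nat \<lceil>t\<^sup>2\<rceil>"
    have "1 \<le> t\<^sup>2" using t1 by (simp add: one_le_power)
    then have J: "t\<^sup>2 \<le> real J" "real J \<le> 2 * t\<^sup>2" "0 < J" unfolding J_def by linarith+
    have "\<bar>\<Sum>m<M. sawtooth (f m - a)\<bar> \<le> real M / real J + 4 * (A\<^sub>0 / sqrt \<epsilon>) * sqrt (real J)"
      using J A0 \<epsilon> by (intro sum_sawtooth_le S) auto
    also have "real M / real J \<le> (K / \<epsilon>) / t\<^sup>2"
      using J M t0 K \<epsilon> by (intro frac_le) auto
    also have "(K / \<epsilon>) / t\<^sup>2 = K * t ^ 4"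
    proof -
      have "K / \<epsilon> = K * t ^ 6" using t6 by (simp add: divide_inverse)
      then show ?thesis using t0 by (simp add: field_simps flip: power_add)
    qed
    also have "4 * (A\<^sub>0 / sqrt \<epsilon>) * sqrt (real J) \<le> 4 * (A\<^sub>0 * t ^ 3) * (2 * t)"
    proof (intro mult_mono)
      show "A\<^sub>0 / sqrt \<epsilon> \<le> A\<^sub>0 * t ^ 3" using t3 by (simp add: divide_inverse)
      have "real J \<le> (2 * t)\<^sup>2" using J(2) by (simp add: power2_eq_square)
      then show "sqrt (real J) \<le> 2 * t" using t0 by (intro real_le_lsqrt) auto
    qed (use A0 t0 \<epsilon> in auto)
    also have "4 * (A\<^sub>0 * t ^ 3) * (2 * t) = 8 * A\<^sub>0 * t ^ 4" by (simp add: eval_nat_numeral)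
    finally show "\<bar>\<Sum>m<M. sawtooth (f m - a)\<bar> \<le> (K + 8 * A\<^sub>0) * \<epsilon> powr (- 2 / 3)"
      unfolding t4 distrib_right by simp
  qed (use A0 K in simp)
qed

section \<open>Counting fractional parts in an interval\<close>

lemma frac_diff_small:
  assumes "0 \<le> b" "b \<le> (1::real)"
  shows "frac (y - b) = (if b \<le> frac y then frac y - b else frac y - b + 1)"
proof -
  have "\<lfloor>y - b\<rfloor> = (if b \<le> frac y then \<lfloor>y\<rfloor> else \<lfloor>y\<rfloor> - 1)"
    using assms frac_ge_0[of y] frac_lt_1[of y]
    by (cases "b \<le> frac y") (simp_all add: floor_eq_iff frac_def, linarith+)
  then show ?thesis by (auto simp: frac_def)
qed

lemma indicator_eq_sawtooth:
  assumes "0 \<le> a" "a \<le> b" "b \<le> 1"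
  shows "of_bool (frac y \<in> {a..<b}) = (b - a) + sawtooth (y - b) - sawtooth (y - a)"
  using assms by (auto simp: sawtooth_def frac_diff_small)

lemma count_half_open:
  fixes y :: "nat \<Rightarrow> real"
  assumes E: "\<And>a. \<bar>\<Sum>m<M. sawtooth (y m - a)\<bar> \<le> E"
    and ab: "0 \<le> a" "a \<le> b" "b \<le> 1"
  shows "\<bar>real (card {m. m < M \<and> frac (y m) \<in> {a..<b}}) - real M * (b - a)\<bar> \<le> 2 * E"
proof -
  have "real (card {m. m < M \<and> frac (y m) \<in> {a..<b}}) = (\<Sum>m<M. of_bool (frac (y m) \<in> {a..<b}))"
    by (simp add: sum.If_cases of_bool_def Int_def)
  also have "\<dots> = (\<Sum>m<M. (b - a) + sawtooth (y m - b) - sawtooth (y m - a))"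
    using ab by (simp only: indicator_eq_sawtooth)
  also have "\<dots> = real M * (b - a) + (\<Sum>m<M. sawtooth (y m - b)) - (\<Sum>m<M. sawtooth (y m - a))"
    by (simp add: sum.distrib sum_subtractf)
  finally show ?thesis using E[of a] E[of b] by linarith
qed

lemma measure_real_interval:
  fixes I :: "real set"
  assumes I: "is_interval I" "I \<noteq> {}" "bdd_above I" "bdd_below I"
  shows "{Inf I<..<Sup I} \<subseteq> I" "I \<subseteq> {Inf I..Sup I}" "measure lborel I = Sup I - Inf I"
proof -
  show sub: "{Inf I<..<Sup I} \<subseteq> I"
  proof
    fix x assume "x \<in> {Inf I<..<Sup I}"
    then obtain u v where "u \<in> I" "u < x" "v \<in> I" "x < v"
      using cInf_less_iff[of I x] less_cSup_iff[of I x] I by auto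
    then show "x \<in> I" using I(1)[unfolded is_interval_1, rule_format, of u v x] by simp
  qed
  show sup: "I \<subseteq> {Inf I..Sup I}" using I by (auto intro: cInf_lower cSup_upper)
  have le: "Inf I \<le> Sup I" using sup I(2) by auto
  have "I = {Inf I<..<Sup I} \<union> (I \<inter> {Inf I, Sup I})" using sub sup by force
  moreover have "I \<inter> {Inf I, Sup I} \<in> null_sets lborel" by (intro finite_imp_null_set_lborel) simp
  ultimately have "measure lborel I = measure lborel {Inf I<..<Sup I}"
    by (metis measure_Un_null_set sets_lborel borel_open open_greaterThanLessThan)
  then show "measure lborel I = Sup I - Inf I" using le by simp
qed

text \<open>
  The identity \<open>indicator_eq_sawtooth\<close> is specific to intervals that contain their left end point
  only. Other intervals are compared with slightly shorter or longer ones of this kind; since the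
  bound \<open>2 * E\<close> does not depend on the interval, the perturbation \<open>\<eta>\<close> can be sent to \<open>0\<close>.
\<close>

lemma count_interval:
  fixes y :: "nat \<Rightarrow> real"
  assumes E: "\<And>a. \<bar>\<Sum>m<M. sawtooth (y m - a)\<bar> \<le> E"
    and I: "is_interval I" "I \<subseteq> {0..<1}"
  shows "\<bar>real (card {m. m < M \<and> frac (y m) \<in> I}) - real M * measure lborel I\<bar> \<le> 2 * E"
proof (cases "I = {}")
  case True
  then show ?thesis using E[of 0] by simp
next
  case False
  have bdd: "bdd_above I" "bdd_below I"
    by (rule bdd_above_mono[OF _ I(2)], simp) (rule bdd_below_mono[OF _ I(2)], simp)
  note J = measure_real_interval[OF I(1) False bdd]
  define a b where "a = Inf I" and "b = Sup I"
  have ab: "0 \<le> a" "a \<le> b" "b \<le> 1"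
  proof -
    show "0 \<le> a" unfolding a_def using I False by (intro cInf_greatest) auto
    show "b \<le> 1" unfolding b_def using I False by (intro cSup_least) force+
    show "a \<le> b" using J(2) False by (auto simp: a_def b_def)
  qed
  have mI: "measure lborel I = b - a" using J by (simp add: a_def b_def)
  let ?c = "\<lambda>I. real (card {m. m < M \<and> frac (y m) \<in> I})"
  have mono: "?c S \<le> ?c T" if "S \<subseteq> T" for S T using that by (auto intro!: card_mono)
  have "?c I \<le> real M * (b - a) + 2 * E"
  proof (cases "b \<in> I")
    case False
    have "x \<in> {a..<b}" if "x \<in> I" for x
    proof -
      have "x \<noteq> b" using that False by auto
      then show ?thesis using subsetD[OF J(2) that] by (simp add: a_def b_def)
    qed
    then have "I \<subseteq> {a..<b}" by blast
    then show ?thesis using mono[of I "{a..<b}"] count_half_open[OF E ab] by linarith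
  next
    case True
    then have b1: "b < 1" using I by auto
    show ?thesis
    proof (rule field_le_epsilon)
      fix e :: real assume e: "0 < e"
      define \<eta> where "\<eta> = min (1 - b) (e / (real M + 1))"
      have \<eta>: "0 < \<eta>" "b + \<eta> \<le> 1" using b1 e by (auto simp: \<eta>_def)
      have "real M * \<eta> \<le> (real M + 1) * (e / (real M + 1))"
        using e \<eta> by (intro mult_mono) (auto simp: \<eta>_def)
      then have "real M * \<eta> \<le> e" by simp
      moreover have "I \<subseteq> {a..<b + \<eta>}" using J(2) \<eta> by (force simp: a_def b_def)
      moreover have "real M * (b + \<eta> - a) = real M * (b - a) + real M * \<eta>" by (simp add: algebra_simps)
      ultimately show "?c I \<le> real M * (b - a) + 2 * E + e"
        using mono[of I "{a..<b + \<eta>}"] count_half_open[OF E, of a "b + \<eta>"] ab \<eta> by linarith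
    qed
  qed
  moreover have "real M * (b - a) - 2 * E \<le> ?c I"
  proof (cases "a = b")
    case True
    then show ?thesis using E[of 0] by (smt (verit) mult_eq_0_iff of_nat_0_le_iff)
  next
    case False
    show ?thesis
    proof (rule field_le_epsilon)
      fix e :: real assume e: "0 < e"
      define \<eta> where "\<eta> = min (b - a) (e / (real M + 1))"
      have \<eta>: "0 < \<eta>" "a + \<eta> \<le> b" using False ab e by (auto simp: \<eta>_def)
      have "real M * \<eta> \<le> (real M + 1) * (e / (real M + 1))"
        using e \<eta> by (intro mult_mono) (auto simp: \<eta>_def)
      then have "real M * \<eta> \<le> e" by simp
      moreover have "{a + \<eta>..<b} \<subseteq> I" using J(1) \<eta> by (force simp: a_def b_def)
      moreover have "real M * (b - (a + \<eta>)) = real M * (b - a) - real M * \<eta>" by (simp add: algebra_simps)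
      ultimately show "real M * (b - a) - 2 * E \<le> ?c I + e"
        using mono[of "{a + \<eta>..<b}" I] count_half_open[OF E, of "a + \<eta>" b] ab \<eta> by linarith
    qed
  qed
  ultimately show ?thesis by (simp add: mI)
qed

section \<open>Lattice points on a line\<close>

text \<open>
  The mean value theorem, applied to \<open>g (\<gamma> (s + 1)) - g (\<gamma> s)\<close> and then to its derivative, writes the
  second difference as \<open>v \<bullet> D p v\<close> at a single point \<open>p\<close> of the segment. One-sided derivatives at the
  end points suffice, so the segment may touch the boundary of \<open>Q\<close>.
\<close>

lemma second_difference_bounds:
  fixes g :: "'a::euclidean_space \<Rightarrow> real"
  assumes C2: "C2_on Q g G D" and Q: "convex Q" and x: "x \<in> Q" "x + 2 *\<^sub>R v \<in> Q"
    and D: "\<And>p. p \<in> Q \<Longrightarrow> lo \<le> v \<bullet> D p v \<and> v \<bullet> D p v \<le> hi"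
  shows "lo \<le> g (x + 2 *\<^sub>R v) - 2 * g (x + v) + g x"
    "g (x + 2 *\<^sub>R v) - 2 * g (x + v) + g x \<le> hi"
proof -
  define \<gamma> where "\<gamma> s = x + s *\<^sub>R v" for s :: real
  have \<gamma>Q: "\<gamma> s \<in> Q" if "s \<in> {0..2}" for s
  proof -
    have "\<gamma> s = (1 - s / 2) *\<^sub>R x + (s / 2) *\<^sub>R (x + 2 *\<^sub>R v)" by (simp add: \<gamma>_def algebra_simps)
    then show ?thesis using convexD[OF Q x, of "1 - s / 2" "s / 2"] that by simp
  qed
  have \<gamma>': "(\<gamma> has_derivative (\<lambda>h. h *\<^sub>R v)) (at s within S)" for s S
    unfolding \<gamma>_def by (auto intro!: derivative_eq_intros)
  have g': "((\<lambda>s. g (\<gamma> s)) has_derivative (\<lambda>h. h * (G (\<gamma> s) \<bullet> v))) (at s within {0..2})"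
    if s: "s \<in> {0..2}" for s
  proof -
    have "(g has_derivative (\<lambda>h. G (\<gamma> s) \<bullet> h)) (at (\<gamma> s) within \<gamma> ` {0..2})"
      using C2 \<gamma>Q s unfolding C2_on_def by (blast intro: has_derivative_subset)
    from has_derivative_in_compose[OF \<gamma>' this] show ?thesis by simp
  qed
  have G': "((\<lambda>s. G (\<gamma> s) \<bullet> v) has_derivative (\<lambda>h. h * (v \<bullet> D (\<gamma> s) v))) (at s within {0..2})"
    if s: "s \<in> {0..2}" for s
  proof -
    have "(G has_derivative blinfun_apply (D (\<gamma> s))) (at (\<gamma> s) within \<gamma> ` {0..2})"
      using C2 \<gamma>Q s unfolding C2_on_def by (blast intro: has_derivative_subset)
    from has_derivative_inner_left[OF has_derivative_in_compose[OF \<gamma>' this], of v] show ?thesis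
      by (simp add: blinfun.scaleR_right inner_commute)
  qed
  have "\<exists>s\<in>{0<..<1}. (g (\<gamma> (1 + 1)) - g (\<gamma> 1)) - (g (\<gamma> (0 + 1)) - g (\<gamma> 0)) =
      (1 - 0) * (G (\<gamma> (s + 1)) \<bullet> v) - (1 - 0) * (G (\<gamma> s) \<bullet> v)"
  proof (rule mvt_simple[where f = "\<lambda>s. g (\<gamma> (s + 1)) - g (\<gamma> s)"
        and f' = "\<lambda>s h. h * (G (\<gamma> (s + 1)) \<bullet> v) - h * (G (\<gamma> s) \<bullet> v)"])
    fix s :: real assume "0 \<le> s" "s \<le> 1"
    then have s: "s \<in> {0..1}" by simp
    have "((\<lambda>s. s + 1) has_derivative (\<lambda>h. h)) (at s within {0..1::real})"
      by (auto intro!: derivative_eq_intros)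
    moreover have "((\<lambda>s. g (\<gamma> s)) has_derivative (\<lambda>h. h * (G (\<gamma> (s + 1)) \<bullet> v))) (at (s + 1) within (\<lambda>s. s + 1) ` {0..1})"
      using s by (intro has_derivative_subset[OF g']) auto
    ultimately have "((\<lambda>s. g (\<gamma> (s + 1))) has_derivative (\<lambda>h. h * (G (\<gamma> (s + 1)) \<bullet> v))) (at s within {0..1})"
      by (rule has_derivative_in_compose)
    moreover have "((\<lambda>s. g (\<gamma> s)) has_derivative (\<lambda>h. h * (G (\<gamma> s) \<bullet> v))) (at s within {0..1})"
      using s by (intro has_derivative_subset[OF g']) auto
    ultimately show "((\<lambda>s. g (\<gamma> (s + 1)) - g (\<gamma> s)) has_derivative
        (\<lambda>h. h * (G (\<gamma> (s + 1)) \<bullet> v) - h * (G (\<gamma> s) \<bullet> v))) (at s within {0..1})"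
      by (rule has_derivative_diff)
  qed simp
  then obtain s where s: "0 < s" "s < 1"
    and eq1: "g (\<gamma> 2) - 2 * g (\<gamma> 1) + g (\<gamma> 0) = G (\<gamma> (s + 1)) \<bullet> v - G (\<gamma> s) \<bullet> v"
    by auto
  have "\<exists>t\<in>{s<..<s + 1}. G (\<gamma> (s + 1)) \<bullet> v - G (\<gamma> s) \<bullet> v = (s + 1 - s) * (v \<bullet> D (\<gamma> t) v)"
    by (rule mvt_simple) (use s in \<open>auto intro!: has_derivative_subset[OF G']\<close>)
  then obtain t where t: "s < t" "t < s + 1" "G (\<gamma> (s + 1)) \<bullet> v - G (\<gamma> s) \<bullet> v = v \<bullet> D (\<gamma> t) v"
    by auto
  have "\<gamma> t \<in> Q" using s t by (intro \<gamma>Q) auto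
  from D[OF this] show "lo \<le> g (x + 2 *\<^sub>R v) - 2 * g (x + v) + g x"
    "g (x + 2 *\<^sub>R v) - 2 * g (x + v) + g x \<le> hi"
    using eq1 t(3) by (auto simp: \<gamma>_def)
qed

lemma mat_mult_vec: "mat c *v v = (c::real) *\<^sub>R (v :: real ^ 'n)"
  by (simp add: vec_eq_iff matrix_vector_mult_def mat_def if_distrib[of "\<lambda>x. x * _"] cong: if_cong)

lemma loewner_le_quadratic_form:
  assumes "loewner_le A B"
  shows "v \<bullet> (A *v v) \<le> v \<bullet> (B *v v)"
  using assms by (simp add: loewner_le_def psd_def matrix_vector_mult_diff_rdistrib inner_diff_right)

lemma matrix_blinfun_apply: "matrix (blinfun_apply (F :: (real ^ 'n) \<Rightarrow>\<^sub>L (real ^ 'n))) *v v = F v"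
  by (rule matrix_vector_mul(3)[OF blinfun.bounded_linear_right, THEN fun_cong])

lemma hessian_quadratic_form:
  fixes F :: "(real ^ 'n) \<Rightarrow>\<^sub>L (real ^ 'n)"
  assumes "loewner_le (mat c) (matrix (blinfun_apply F))" "loewner_le (matrix (blinfun_apply F)) (mat C)"
  shows "c * (v \<bullet> v) \<le> v \<bullet> F v" "v \<bullet> F v \<le> C * (v \<bullet> v)"
  using assms[THEN loewner_le_quadratic_form, of v] by (simp_all add: mat_mult_vec matrix_blinfun_apply)

lemma lattice_pts_iff:
  assumes "\<epsilon> > 0"
  shows "k \<in> lattice_pts Q \<epsilon> \<longleftrightarrow> (\<forall>i. k $ i \<in> \<int>) \<and> \<epsilon> *\<^sub>R k \<in> Q"
proof -
  have "k \<in> (\<lambda>x. inverse \<epsilon> *\<^sub>R x) ` Q \<longleftrightarrow> \<epsilon> *\<^sub>R k \<in> Q"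
    using assms by (force simp: image_iff)
  then show ?thesis by (auto simp: lattice_pts_def)
qed

lemma finite_convex_int_set:
  fixes Z :: "int set"
  assumes "finite Z" "\<And>a b m. a \<in> Z \<Longrightarrow> b \<in> Z \<Longrightarrow> a \<le> m \<Longrightarrow> m \<le> b \<Longrightarrow> m \<in> Z"
  obtains a where "Z = (\<lambda>m. a + int m) ` {..<card Z}"
proof (cases "Z = {}")
  case True
  then show ?thesis using that by simp
next
  case False
  have mm: "Min Z \<in> Z" "Max Z \<in> Z" using assms(1) False by auto
  have eq: "Z = {Min Z..Max Z}"
  proof (intro equalityI subsetI)
    fix m assume "m \<in> {Min Z..Max Z}"
    then show "m \<in> Z" using assms(2)[OF mm, of m] by simp
  qed (use assms(1) in simp)
  have "Z = (\<lambda>m. Min Z + int m) ` {..<card Z}"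
  proof -
    have "card Z = nat (Max Z - Min Z + 1)" by (subst eq) simp
    moreover have "{Min Z..Max Z} = (\<lambda>m. Min Z + int m) ` {..<nat (Max Z - Min Z + 1)}"
    proof (intro equalityI subsetI)
      fix x assume "x \<in> {Min Z..Max Z}"
      then show "x \<in> (\<lambda>m. Min Z + int m) ` {..<nat (Max Z - Min Z + 1)}"
        by (intro image_eqI[of _ _ "nat (x - Min Z)"]) auto
    qed auto
    ultimately show ?thesis using eq by simp
  qed
  then show ?thesis by (rule that)
qed

definition flatten :: "'n::finite \<Rightarrow> real ^ 'n \<Rightarrow> real ^ 'n" where
  "flatten i k = k - (k $ i) *\<^sub>R axis i 1"

lemma flatten_nth: "flatten i k $ j = (if j = i then 0 else k $ j)"
  by (auto simp: flatten_def axis_def)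

text \<open>
  Each fibre of \<open>flatten i\<close> is a line parallel to a coordinate axis. Convexity of \<open>Q\<close> makes the lattice
  points on it consecutive, and boundedness leaves \<open>O(1 / \<epsilon>)\<close> of them. A unit step in \<open>k\<close> moves
  \<open>\<epsilon> *\<^sub>R k\<close> by \<open>\<epsilon>\<close>, so the second differences of \<open>g (\<epsilon> *\<^sub>R k) / \<epsilon>\<close> are Hessian values times
  \<open>\<epsilon>\<^sup>2 / \<epsilon>\<close>. The constant \<open>B\<close> is uniform in the line and in \<open>I\<close>.
\<close>

lemma fiber_discrepancy:
  fixes Q :: "(real ^ 'n) set" and i :: 'n
  assumes Q: "convex Q" "\<And>x. x \<in> Q \<Longrightarrow> norm x \<le> R" and R: "0 \<le> R"
    and C2: "C2_on Q g G D"
    and c: "0 < c" "0 \<le> C"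
    and D: "\<And>x v. x \<in> Q \<Longrightarrow> c * (v \<bullet> v) \<le> v \<bullet> D x v \<and> v \<bullet> D x v \<le> C * (v \<bullet> v)"
  obtains B where "0 \<le> B"
    "\<And>\<epsilon> I p. \<lbrakk>0 < \<epsilon>; \<epsilon> \<le> 1; is_interval I; I \<subseteq> {0..<1}; p $ i = 0; \<forall>j. p $ j \<in> \<int>\<rbrakk> \<Longrightarrow>
      finite {k \<in> lattice_pts Q \<epsilon>. flatten i k = p} \<and>
      \<bar>real (card {k \<in> lattice_pts Q \<epsilon>. flatten i k = p \<and> frac (g (\<epsilon> *\<^sub>R k) / \<epsilon>) \<in> I})
        - real (card {k \<in> lattice_pts Q \<epsilon>. flatten i k = p}) * measure lborel I\<bar> \<le> B * \<epsilon> powr (- 2 / 3)"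
proof -
  obtain B where B: "0 \<le> B"
    "\<And>\<epsilon> M f a. \<lbrakk>0 < \<epsilon>; \<epsilon> \<le> 1; real M \<le> (2 * R + 1) / \<epsilon>;
      \<And>m. Suc (Suc m) < M \<Longrightarrow> c * \<epsilon> \<le> f (Suc (Suc m)) - 2 * f (Suc m) + f m \<and>
                  f (Suc (Suc m)) - 2 * f (Suc m) + f m \<le> C * \<epsilon>\<rbrakk>
     \<Longrightarrow> \<bar>\<Sum>m<M. sawtooth (f m - a)\<bar> \<le> B * \<epsilon> powr (- 2 / 3)"
    using sum_sawtooth_curved_le[of c C "2 * R + 1"] c R by (metis add_nonneg_nonneg mult_nonneg_nonneg zero_le_numeral zero_le_one)
  show ?thesis
  proof (rule that[of "2 * B"])
    fix \<epsilon> :: real and I :: "real set" and p :: "real ^ 'n"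
    assume \<epsilon>: "0 < \<epsilon>" "\<epsilon> \<le> 1" and I: "is_interval I" "I \<subseteq> {0..<1}" and p: "p $ i = 0" "\<forall>j. p $ j \<in> \<int>"
    define e :: "real ^ 'n" where "e = axis i 1"
    define pt where "pt m = p + of_int m *\<^sub>R e" for m :: int
    \<comment> \<open>\<open>pt\<close> parametrizes the lattice points of the line, and \<open>Z\<close> selects those in the scaled \<open>Q\<close>.\<close>
    define Z where "Z = {m. \<epsilon> *\<^sub>R pt m \<in> Q}"
    let ?F = "{k \<in> lattice_pts Q \<epsilon>. flatten i k = p}"
    have pt_nth: "pt m $ j = (if j = i then of_int m else p $ j)" for m j
      using p by (simp add: pt_def e_def axis_def)
    have pt_inj: "inj pt" by (rule injI) (metis pt_nth of_int_eq_iff)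
    have F: "?F = pt ` Z"
    proof (intro equalityI subsetI)
      fix k assume "k \<in> ?F"
      then have k: "\<forall>j. k $ j \<in> \<int>" "\<epsilon> *\<^sub>R k \<in> Q" "flatten i k = p"
        using \<epsilon> by (auto simp: lattice_pts_iff)
      obtain m where m: "k $ i = of_int m" using k(1) by (metis Ints_cases)
      have "k = pt m" using k(3) m by (simp add: pt_def e_def flatten_def flip: k(3))
      then show "k \<in> pt ` Z" using k by (auto simp: Z_def)
    next
      fix k assume "k \<in> pt ` Z"
      then obtain m where m: "k = pt m" "\<epsilon> *\<^sub>R pt m \<in> Q" by (auto simp: Z_def)
      have "flatten i k = p" using p m by (simp add: vec_eq_iff flatten_nth pt_nth)
      then show "k \<in> ?F" using m p \<epsilon> by (simp add: lattice_pts_iff pt_nth)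
    qed
    have Zsub: "Z \<subseteq> {- \<lfloor>R / \<epsilon>\<rfloor>..\<lfloor>R / \<epsilon>\<rfloor>}"
    proof
      fix m assume "m \<in> Z"
      then have "\<bar>(\<epsilon> *\<^sub>R pt m) $ i\<bar> \<le> R"
        using Q(2)[of "\<epsilon> *\<^sub>R pt m"] component_le_norm_cart[of "\<epsilon> *\<^sub>R pt m" i] by (simp add: Z_def)
      then have "real_of_int \<bar>m\<bar> \<le> R / \<epsilon>" using \<epsilon> by (simp add: pt_nth abs_mult field_simps)
      then have "\<bar>m\<bar> \<le> \<lfloor>R / \<epsilon>\<rfloor>" by (simp add: le_floor_iff)
      then show "m \<in> {- \<lfloor>R / \<epsilon>\<rfloor>..\<lfloor>R / \<epsilon>\<rfloor>}" by auto
    qed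
    then have fin: "finite Z" by (rule finite_subset) simp
    have "card Z \<le> card {- \<lfloor>R / \<epsilon>\<rfloor>..\<lfloor>R / \<epsilon>\<rfloor>}" using Zsub by (intro card_mono) auto
    moreover have "0 \<le> \<lfloor>R / \<epsilon>\<rfloor>" using R \<epsilon> by simp
    ultimately have "real (card Z) \<le> 2 * (R / \<epsilon>) + 1" by simp linarith
    also have "\<dots> \<le> (2 * R + 1) / \<epsilon>" using \<epsilon> by (simp add: field_simps)
    finally have cardZ: "real (card Z) \<le> (2 * R + 1) / \<epsilon>" .
    have conv: "m \<in> Z" if "a \<in> Z" "b \<in> Z" "a \<le> m" "m \<le> b" for a b m
    proof (cases "a = b")
      case False
      define u where "u = real_of_int (m - a) / real_of_int (b - a)"
      have u: "0 \<le> u" "u \<le> 1" "real_of_int m = (1 - u) * of_int a + u * of_int b"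
      proof -
        have "u * real_of_int (b - a) = real_of_int (m - a)" using that False by (simp add: u_def)
        then show "real_of_int m = (1 - u) * of_int a + u * of_int b" by (simp add: algebra_simps)
      qed (use that False in \<open>auto simp: u_def\<close>)
      have "\<epsilon> *\<^sub>R pt m = (1 - u) *\<^sub>R (\<epsilon> *\<^sub>R pt a) + u *\<^sub>R (\<epsilon> *\<^sub>R pt b)"
        unfolding pt_def u(3) by (simp add: algebra_simps)
      then show ?thesis using convexD[OF Q(1), of "\<epsilon> *\<^sub>R pt a" "\<epsilon> *\<^sub>R pt b" "1 - u" u] u that
        by (simp add: Z_def)
    qed (use that in auto)
    obtain a where a: "Z = (\<lambda>m. a + int m) ` {..<card Z}"
      by (rule finite_convex_int_set[OF fin conv])
    define M where "M = card Z"
    define h where "h m = g (\<epsilon> *\<^sub>R pt (a + int m)) / \<epsilon>" for m :: nat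
    have ptQ: "\<epsilon> *\<^sub>R pt (a + int m) \<in> Q" if "m < M" for m
    proof -
      have "a + int m \<in> Z" by (subst a) (use that in \<open>auto simp: M_def\<close>)
      then show ?thesis by (simp add: Z_def)
    qed
    have D2h: "c * \<epsilon> \<le> h (Suc (Suc m)) - 2 * h (Suc m) + h m \<and>
                  h (Suc (Suc m)) - 2 * h (Suc m) + h m \<le> C * \<epsilon>" if m: "Suc (Suc m) < M" for m
    proof -
      let ?x = "\<epsilon> *\<^sub>R pt (a + int m)" and ?v = "\<epsilon> *\<^sub>R e"
      have step: "\<epsilon> *\<^sub>R pt (n + 1) = \<epsilon> *\<^sub>R pt n + ?v" for n
        by (simp add: pt_def algebra_simps)
      have x1: "\<epsilon> *\<^sub>R pt (a + int (Suc m)) = ?x + ?v"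
        using step[of "a + int m"] by (simp add: algebra_simps)
      have x2: "\<epsilon> *\<^sub>R pt (a + int (Suc (Suc m))) = ?x + 2 *\<^sub>R ?v"
        using step[of "a + int (Suc m)"] unfolding x1 scaleR_2 by (simp only: of_nat_Suc add_ac)
      have vv: "?v \<bullet> ?v = \<epsilon>\<^sup>2" by (simp add: e_def inner_axis_axis power2_eq_square)
      have "c * \<epsilon>\<^sup>2 \<le> g (?x + 2 *\<^sub>R ?v) - 2 * g (?x + ?v) + g ?x"
        "g (?x + 2 *\<^sub>R ?v) - 2 * g (?x + ?v) + g ?x \<le> C * \<epsilon>\<^sup>2"
        using second_difference_bounds[OF C2 Q(1), of ?x ?v "c * \<epsilon>\<^sup>2" "C * \<epsilon>\<^sup>2"] D[of _ ?v]
          ptQ[of m] ptQ[of "Suc (Suc m)"] m unfolding vv x2 by auto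
      moreover have "h (Suc (Suc m)) - 2 * h (Suc m) + h m = (g (?x + 2 *\<^sub>R ?v) - 2 * g (?x + ?v) + g ?x) / \<epsilon>"
        unfolding h_def x1 x2 by (simp add: add_divide_distrib diff_divide_distrib)
      ultimately show ?thesis using \<epsilon> by (simp add: pos_le_divide_eq pos_divide_le_eq power2_eq_square mult.assoc)
    qed
    have "\<bar>real (card {m. m < M \<and> frac (h m) \<in> I}) - real M * measure lborel I\<bar> \<le> 2 * (B * \<epsilon> powr (- 2 / 3))"
      using \<epsilon> cardZ D2h by (intro count_interval I B(2)) (auto simp: M_def)
    moreover have "card {k \<in> lattice_pts Q \<epsilon>. flatten i k = p \<and> frac (g (\<epsilon> *\<^sub>R k) / \<epsilon>) \<in> I} = card {m. m < M \<and> frac (h m) \<in> I}"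
    proof -
      have "{k \<in> lattice_pts Q \<epsilon>. flatten i k = p \<and> frac (g (\<epsilon> *\<^sub>R k) / \<epsilon>) \<in> I} = {k \<in> ?F. frac (g (\<epsilon> *\<^sub>R k) / \<epsilon>) \<in> I}"
        by auto
      also have "\<dots> = (\<lambda>m. pt (a + int m)) ` {m. m < M \<and> frac (h m) \<in> I}"
        unfolding F by (subst a) (auto simp: h_def M_def)
      finally have eq: "{k \<in> lattice_pts Q \<epsilon>. flatten i k = p \<and> frac (g (\<epsilon> *\<^sub>R k) / \<epsilon>) \<in> I} =
        (\<lambda>m. pt (a + int m)) ` {m. m < M \<and> frac (h m) \<in> I}" .
      have "inj (\<lambda>m. pt (a + int m))"
        by (intro injI) (drule injD[OF pt_inj], simp)
      then show ?thesis unfolding eq by (intro card_image) (rule inj_on_subset, auto)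
    qed
    moreover have "card ?F = M" unfolding F M_def by (rule card_image) (use pt_inj inj_on_subset in blast)
    moreover have "finite ?F" unfolding F using fin by simp
    ultimately show "finite ?F \<and> \<bar>real (card {k \<in> lattice_pts Q \<epsilon>. flatten i k = p \<and> frac (g (\<epsilon> *\<^sub>R k) / \<epsilon>) \<in> I})
        - real (card ?F) * measure lborel I\<bar> \<le> 2 * B * \<epsilon> powr (- 2 / 3)"
      by simp
  qed (use B in simp)
qed

section \<open>Lattice points in a convex body\<close>

lemma card_integer_points_hyperplane:
  fixes S :: "(real ^ 'n) set" and i :: 'n
  assumes S: "\<And>k. k \<in> S \<Longrightarrow> (\<forall>j. k $ j \<in> \<int> \<and> \<bar>k $ j\<bar> \<le> B) \<and> k $ i = 0" and B: "0 \<le> B"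
  shows "finite S" "real (card S) \<le> (2 * B + 1) ^ (CARD('n) - 1)"
proof -
  let ?T = "PiE (UNIV - {i}) (\<lambda>_. {- \<lfloor>B\<rfloor>..\<lfloor>B\<rfloor>})"
  let ?f = "\<lambda>k. restrict (\<lambda>j. \<lfloor>k $ j\<rfloor>) (UNIV - {i})"
  have inj: "inj_on ?f S"
  proof (rule inj_onI)
    fix k l assume kl: "k \<in> S" "l \<in> S" and eq: "?f k = ?f l"
    have "k $ j = l $ j" for j
    proof (cases "j = i")
      case True
      then show ?thesis using S kl by simp
    next
      case False
      then have "\<lfloor>k $ j\<rfloor> = \<lfloor>l $ j\<rfloor>" using fun_cong[OF eq, of j] by simp
      moreover have "k $ j \<in> \<int>" "l $ j \<in> \<int>" using S kl by auto
      ultimately show ?thesis by (metis floor_of_int Ints_cases)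
    qed
    then show "k = l" by (simp add: vec_eq_iff)
  qed
  have sub: "?f ` S \<subseteq> ?T"
  proof
    fix x assume "x \<in> ?f ` S"
    then obtain k where k: "k \<in> S" "x = ?f k" by auto
    have "\<lfloor>k $ j\<rfloor> \<in> {- \<lfloor>B\<rfloor>..\<lfloor>B\<rfloor>}" for j
    proof -
      obtain m where m: "k $ j = of_int m" using S[OF k(1)] by (metis Ints_cases)
      then have "of_int \<bar>m\<bar> \<le> B" using S[OF k(1)] by (metis of_int_abs)
      then have "\<bar>m\<bar> \<le> \<lfloor>B\<rfloor>" by (simp add: le_floor_iff)
      then show ?thesis using m by auto
    qed
    then show "x \<in> ?T" using k(2) by auto
  qed
  have finT: "finite ?T" by (intro finite_PiE) auto
  show "finite S" using inj_on_finite[OF inj sub finT] .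
  have "card S \<le> card ?T" by (rule card_inj_on_le[OF inj sub finT])
  also have "card ?T = (nat (2 * \<lfloor>B\<rfloor> + 1)) ^ (CARD('n) - 1)"
    by (simp add: card_PiE algebra_simps)
  finally have "real (card S) \<le> real (nat (2 * \<lfloor>B\<rfloor> + 1)) ^ (CARD('n) - 1)"
    unfolding of_nat_power[symmetric] of_nat_le_iff .
  also have "\<dots> \<le> (2 * B + 1) ^ (CARD('n) - 1)"
    using B by (intro power_mono) auto
  finally show "real (card S) \<le> (2 * B + 1) ^ (CARD('n) - 1)" .
qed

lemma is_cube_convex_body:
  fixes Q :: "(real ^ 'n) set"
  assumes "is_cube Q"
  shows "convex Q" "bounded Q" "interior Q \<noteq> {}"
proof -
  obtain J :: "real set" and f :: "real ^ 'n \<Rightarrow> real ^ 'n" and a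
    where J: "is_interval J \<and> bounded J \<and> interior J \<noteq> {} \<and> orthogonal_transformation f \<and>
       Q = (\<lambda>x. a + f x) ` {x. \<forall>i. x $ i \<in> J}"
    using assms[unfolded is_cube_def] by (elim exE) (rule that)
  define S where "S = {x :: real ^ 'n. \<forall>i. x $ i \<in> J}"
  have Q: "Q = (+) a ` f ` S" using J by (simp add: S_def image_image)
  have f: "linear f" "inj f"
    using J by (auto intro: orthogonal_transformation_linear orthogonal_transformation_inj)
  have "convex J" using J by (simp add: is_interval_convex)
  then have "convex S" unfolding S_def by (intro convexI) (auto dest: convexD)
  then show "convex Q" unfolding Q using f(1) by (intro convex_translation convex_linear_image)
  obtain b where b: "\<And>x. x \<in> J \<Longrightarrow> \<bar>x\<bar> \<le> b" using J by (auto simp: bounded_iff)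
  have "bounded S"
  proof (rule boundedI)
    fix x assume "x \<in> S"
    then have "(\<Sum>i\<in>UNIV. \<bar>x $ i\<bar>) \<le> (\<Sum>i\<in>(UNIV :: 'n set). b)"
      by (intro sum_mono b) (auto simp: S_def)
    then show "norm x \<le> (\<Sum>i\<in>(UNIV :: 'n set). b)" using norm_le_l1_cart[of x] by linarith
  qed
  then show "bounded Q" unfolding Q
    by (intro bounded_translation bounded_linear_image f(1)[THEN linear_conv_bounded_linear[THEN iffD1]])
  obtain c where c: "c \<in> interior J" using J by auto
  have "open {x :: real ^ 'n. \<forall>i. x $ i \<in> interior J}"
  proof -
    have "{x :: real ^ 'n. \<forall>i. x $ i \<in> interior J} = (\<Inter>i. (\<lambda>x. x $ i) -` interior J)" by auto
    then show ?thesis by (auto intro!: open_INT open_vimage continuous_intros)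
  qed
  moreover have "{x :: real ^ 'n. \<forall>i. x $ i \<in> interior J} \<subseteq> S"
    unfolding S_def using interior_subset by blast
  ultimately have "(\<chi> i. c) \<in> interior S" using c by (intro interiorI) auto
  then show "interior Q \<noteq> {}"
    unfolding Q using f by (auto simp: interior_translation interior_injective_linear_image)
qed

text \<open>
  \<open>Q\<close> contains a ball and hence an axis-parallel cube \<open>x + [0, s]\<^sup>n\<close>, with \<open>n = CARD('n)\<close>; scaled
  by \<open>1 / \<epsilon>\<close> it has at least \<open>\<lfloor>s / \<epsilon>\<rfloor>\<close> integers along each edge.
\<close>

lemma card_lattice_pts_ge:
  fixes Q :: "(real ^ 'n) set"
  assumes int: "interior Q \<noteq> {}"
    and fin: "\<And>\<epsilon>. \<lbrakk>0 < \<epsilon>; \<epsilon> \<le> 1\<rbrakk> \<Longrightarrow> finite (lattice_pts Q \<epsilon>)"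
  obtains s where "0 < s" "s \<le> 1"
    "\<And>\<epsilon>. \<lbrakk>0 < \<epsilon>; \<epsilon> \<le> s\<rbrakk> \<Longrightarrow> (s / (2 * \<epsilon>)) ^ CARD('n) \<le> real (card (lattice_pts Q \<epsilon>))"
proof -
  obtain x r where r: "0 < r" "ball x r \<subseteq> Q" using int by (auto simp: mem_interior ex_in_conv[symmetric])
  define s where "s = min 1 (r / (2 * CARD('n)))"
  have s: "0 < s" "s \<le> 1" "CARD('n) * s < r"
  proof -
    have "CARD('n) * s \<le> CARD('n) * (r / (2 * CARD('n)))" by (intro mult_left_mono) (auto simp: s_def)
    also have "\<dots> = r / 2" by simp
    also have "\<dots> < r" using r by simp
    finally show "CARD('n) * s < r" .
  qed (use r in \<open>auto simp: s_def\<close>)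
  have box: "y \<in> Q" if "\<And>i. \<bar>y $ i - x $ i\<bar> \<le> s" for y
  proof -
    have "norm (y - x) \<le> (\<Sum>i\<in>UNIV. \<bar>(y - x) $ i\<bar>)" by (rule norm_le_l1_cart)
    also have "\<dots> \<le> (\<Sum>i\<in>(UNIV :: 'n set). s)" by (intro sum_mono) (use that in auto)
    also have "\<dots> < r" using s by simp
    finally show ?thesis using r by (auto simp: dist_norm norm_minus_commute)
  qed
  show ?thesis
  proof (rule that[OF s(1,2)])
    fix \<epsilon> :: real assume \<epsilon>: "0 < \<epsilon>" "\<epsilon> \<le> s"
    define P where "P = nat \<lfloor>s / \<epsilon>\<rfloor>"
    have "1 \<le> s / \<epsilon>" using \<epsilon> by simp
    then have P: "s / (2 * \<epsilon>) \<le> real P" "real P \<le> s / \<epsilon>"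
    proof -
      have P': "real P = of_int \<lfloor>s / \<epsilon>\<rfloor>" using \<open>1 \<le> s / \<epsilon>\<close> by (simp add: P_def)
      show "real P \<le> s / \<epsilon>" unfolding P' by (rule of_int_floor_le)
      have "q / 2 \<le> of_int \<lfloor>q\<rfloor>" if "1 \<le> q" for q :: real
      proof -
        have "1 \<le> real_of_int \<lfloor>q\<rfloor>" using that by simp
        then show ?thesis using real_of_int_floor_add_one_gt[of q] by linarith
      qed
      from this[OF \<open>1 \<le> s / \<epsilon>\<close>] show "s / (2 * \<epsilon>) \<le> real P" unfolding P' by (simp add: mult.commute)
    qed
    define f where "f v = (\<chi> i. real_of_int (\<lceil>x $ i / \<epsilon>\<rceil> + int (v i)))" for v :: "'n \<Rightarrow> nat"
    let ?T = "PiE UNIV (\<lambda>_ :: 'n. {..<P})"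
    have "card ?T \<le> card (lattice_pts Q \<epsilon>)"
    proof (rule card_inj_on_le)
      show "inj_on f ?T" by (rule inj_onI) (auto simp: f_def vec_eq_iff)
      show "f ` ?T \<subseteq> lattice_pts Q \<epsilon>"
      proof
        fix k assume "k \<in> f ` ?T"
        then obtain v where "v \<in> ?T" "k = f v" by auto
        then have v: "\<And>i. v i < P" "k = f v" by auto
        have "\<bar>(\<epsilon> *\<^sub>R k) $ i - x $ i\<bar> \<le> s" for i
        proof -
          define q where "q = x $ i / \<epsilon>"
          have xq: "x $ i = \<epsilon> * q" using \<epsilon> by (simp add: q_def)
          have vi: "real (v i) + 1 \<le> s / \<epsilon>" using v(1)[of i] P(2) by linarith
          have "k $ i = of_int \<lceil>q\<rceil> + real (v i)" by (simp add: v(2) f_def q_def)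
          moreover have "q \<le> of_int \<lceil>q\<rceil>" "of_int \<lceil>q\<rceil> < q + 1"
            using ceiling_correct[of q] by linarith+
          ultimately have "0 \<le> k $ i - q" "k $ i - q \<le> s / \<epsilon>" using vi by linarith+
          then have "0 \<le> \<epsilon> * (k $ i - q)" "\<epsilon> * (k $ i - q) \<le> \<epsilon> * (s / \<epsilon>)"
            using \<epsilon>(1) by (simp, intro mult_left_mono) auto
          then show ?thesis using \<epsilon> by (simp add: xq right_diff_distrib)
        qed
        then have "\<epsilon> *\<^sub>R k \<in> Q" by (rule box)
        then show "k \<in> lattice_pts Q \<epsilon>" using \<epsilon> v(2) by (simp add: lattice_pts_iff f_def)
      qed
      show "finite (lattice_pts Q \<epsilon>)" using fin \<epsilon> s by simp
    qed
    then have "real P ^ CARD('n) \<le> real (card (lattice_pts Q \<epsilon>))"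
      by (simp add: card_PiE flip: of_nat_power)
    moreover have "(s / (2 * \<epsilon>)) ^ CARD('n) \<le> real P ^ CARD('n)"
      using P \<epsilon> s by (intro power_mono) auto
    ultimately show "(s / (2 * \<epsilon>)) ^ CARD('n) \<le> real (card (lattice_pts Q \<epsilon>))" by linarith
  qed
qed

text \<open>
  There are \<open>O(\<epsilon> powr (1 - n))\<close> lines, where \<open>n = CARD('n)\<close>, each with an error
  \<open>O(\<epsilon> powr (- 2 / 3))\<close>, whereas the number of lattice points is at least of order
  \<open>\<epsilon> powr (- n)\<close>. The quotient is of order \<open>\<epsilon> powr (1 / 3)\<close>.
\<close>

lemma lattice_discrepancy:
  fixes Q :: "(real ^ 'n) set"
  assumes Q: "convex Q" "bounded Q" "interior Q \<noteq> {}"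
    and C2: "C2_on Q g G D"
    and c: "0 < c" "0 \<le> C"
    and D: "\<And>x v. x \<in> Q \<Longrightarrow> c * (v \<bullet> v) \<le> v \<bullet> D x v \<and> v \<bullet> D x v \<le> C * (v \<bullet> v)"
  obtains K s where "0 < s"
    "\<And>\<epsilon> I. \<lbrakk>0 < \<epsilon>; \<epsilon> \<le> s; is_interval I; I \<subseteq> {0..<1}\<rbrakk> \<Longrightarrow>
      \<bar>real (A_count Q g I \<epsilon>) / real (N_count Q \<epsilon>) - measure lborel I\<bar> \<le> K * \<epsilon> powr (1 / 3)"
proof -
  obtain R where R: "0 < R" "\<And>x. x \<in> Q \<Longrightarrow> norm x \<le> R" using Q(2) by (auto simp: bounded_pos)
  \<comment> \<open>Any coordinate axis will do as the direction of the lines.\<close>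
  define i where "i = (undefined :: 'n)"
  obtain B where B: "0 \<le> B"
    "\<And>\<epsilon> I p. \<lbrakk>0 < \<epsilon>; \<epsilon> \<le> 1; is_interval I; I \<subseteq> {0..<1}; p $ i = 0; \<forall>j. p $ j \<in> \<int>\<rbrakk> \<Longrightarrow>
      finite {k \<in> lattice_pts Q \<epsilon>. flatten i k = p} \<and>
      \<bar>real (card {k \<in> lattice_pts Q \<epsilon>. flatten i k = p \<and> frac (g (\<epsilon> *\<^sub>R k) / \<epsilon>) \<in> I})
        - real (card {k \<in> lattice_pts Q \<epsilon>. flatten i k = p}) * measure lborel I\<bar> \<le> B * \<epsilon> powr (- 2 / 3)"
    using fiber_discrepancy[OF Q(1) R(2) less_imp_le[OF R(1)] C2 c D, of i] by blast
  \<comment> \<open>One representative for each line that meets the lattice points of \<open>Q\<close>.\<close>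
  define L where "L \<epsilon> = flatten i ` lattice_pts Q \<epsilon>" for \<epsilon>
  have L: "finite (L \<epsilon>)" "real (card (L \<epsilon>)) \<le> ((2 * R + 1) / \<epsilon>) ^ (CARD('n) - 1)"
    "\<And>p. p \<in> L \<epsilon> \<Longrightarrow> p $ i = 0 \<and> (\<forall>j. p $ j \<in> \<int>)" if \<epsilon>: "0 < \<epsilon>" "\<epsilon> \<le> 1" for \<epsilon>
  proof -
    have mem: "(\<forall>j. p $ j \<in> \<int> \<and> \<bar>p $ j\<bar> \<le> R / \<epsilon>) \<and> p $ i = 0" if p: "p \<in> L \<epsilon>" for p
    proof -
      obtain k where k: "p = flatten i k" "\<forall>j. k $ j \<in> \<int>" "\<epsilon> *\<^sub>R k \<in> Q"
        using p \<epsilon> by (auto simp: L_def lattice_pts_iff)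
      have "\<bar>k $ j\<bar> \<le> R / \<epsilon>" for j
        using order.trans[OF component_le_norm_cart R(2)[OF k(3)], of j] \<epsilon> by (simp add: abs_mult field_simps)
      then show ?thesis using k R \<epsilon> by (auto simp: flatten_nth)
    qed
    have R\<epsilon>: "0 \<le> R / \<epsilon>" using R \<epsilon> by simp
    show "finite (L \<epsilon>)" by (rule card_integer_points_hyperplane(1)[OF mem R\<epsilon>])
    have "real (card (L \<epsilon>)) \<le> (2 * (R / \<epsilon>) + 1) ^ (CARD('n) - 1)"
      by (rule card_integer_points_hyperplane(2)[OF mem R\<epsilon>])
    also have "\<dots> \<le> ((2 * R + 1) / \<epsilon>) ^ (CARD('n) - 1)"
      using R \<epsilon> by (intro power_mono) (auto simp: field_simps)
    finally show "real (card (L \<epsilon>)) \<le> ((2 * R + 1) / \<epsilon>) ^ (CARD('n) - 1)" .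
    show "\<And>p. p \<in> L \<epsilon> \<Longrightarrow> p $ i = 0 \<and> (\<forall>j. p $ j \<in> \<int>)" using mem by blast
  qed
  have fin: "finite (lattice_pts Q \<epsilon>)" if \<epsilon>: "0 < \<epsilon>" "\<epsilon> \<le> 1" for \<epsilon>
  proof -
    have "lattice_pts Q \<epsilon> = (\<Union>p\<in>L \<epsilon>. {k \<in> lattice_pts Q \<epsilon>. flatten i k = p})" by (auto simp: L_def)
    moreover have "finite {k \<in> lattice_pts Q \<epsilon>. flatten i k = p}" if "p \<in> L \<epsilon>" for p
      using B(2)[OF \<epsilon>, of "{}" p] L(3)[OF \<epsilon> that] by simp
    ultimately show ?thesis using L(1)[OF \<epsilon>] by (metis (no_types, lifting) finite_UN)
  qed
  obtain s where s: "0 < s" "s \<le> 1"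
    "\<And>\<epsilon>. \<lbrakk>0 < \<epsilon>; \<epsilon> \<le> s\<rbrakk> \<Longrightarrow> (s / (2 * \<epsilon>)) ^ CARD('n) \<le> real (card (lattice_pts Q \<epsilon>))"
    using card_lattice_pts_ge[OF Q(3) fin] by blast
  define n where "n = CARD('n) - 1"
  have n: "CARD('n) = Suc n" by (simp add: n_def)
  define K where "K = (2 * R + 1) ^ n * B * (2 / s) ^ Suc n"
  show ?thesis
  proof (rule that[OF s(1)])
    fix \<epsilon> :: real and I :: "real set"
    assume \<epsilon>: "0 < \<epsilon>" "\<epsilon> \<le> s" and I: "is_interval I" "I \<subseteq> {0..<1}"
    have \<epsilon>1: "\<epsilon> \<le> 1" using \<epsilon> s by simp
    note L = L[OF \<epsilon>(1) \<epsilon>1] and fin = fin[OF \<epsilon>(1) \<epsilon>1]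
    let ?S = "lattice_pts Q \<epsilon>" and ?P = "\<lambda>k. frac (g (\<epsilon> *\<^sub>R k) / \<epsilon>) \<in> I"
    have N: "real (N_count Q \<epsilon>) = (\<Sum>p\<in>L \<epsilon>. real (card {k \<in> ?S. flatten i k = p}))"
      using sum.group[OF fin L(1), of "flatten i" "\<lambda>_. 1 :: real"] by (simp add: L_def N_count_def)
    have A: "real (A_count Q g I \<epsilon>) = (\<Sum>p\<in>L \<epsilon>. real (card {k \<in> ?S. flatten i k = p \<and> ?P k}))"
    proof -
      have "(\<Sum>p\<in>L \<epsilon>. \<Sum>k\<in>{k \<in> {k \<in> ?S. ?P k}. flatten i k = p}. 1 :: real) = (\<Sum>k\<in>{k \<in> ?S. ?P k}. 1)"
        using fin L(1) by (intro sum.group) (auto simp: L_def)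
      moreover have "{k \<in> {k \<in> ?S. ?P k}. flatten i k = p} = {k \<in> ?S. flatten i k = p \<and> ?P k}" for p by auto
      ultimately show ?thesis by (simp add: A_count_def)
    qed
    have "\<bar>real (A_count Q g I \<epsilon>) - real (N_count Q \<epsilon>) * measure lborel I\<bar> =
       \<bar>\<Sum>p\<in>L \<epsilon>. real (card {k \<in> ?S. flatten i k = p \<and> ?P k}) - real (card {k \<in> ?S. flatten i k = p}) * measure lborel I\<bar>"
      by (simp add: A N sum_subtractf sum_distrib_right)
    also have "\<dots> \<le> (\<Sum>p\<in>L \<epsilon>. B * \<epsilon> powr (- 2 / 3))"
      by (intro order.trans[OF sum_abs] sum_mono) (use B(2)[OF \<epsilon>(1) \<epsilon>1 I] L(3) in blast)
    also have "\<dots> = real (card (L \<epsilon>)) * (B * \<epsilon> powr (- 2 / 3))" by simp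
    also have "\<dots> \<le> ((2 * R + 1) / \<epsilon>) ^ n * (B * \<epsilon> powr (- 2 / 3))"
      using L(2) B(1) by (intro mult_right_mono) (auto simp: n_def)
    finally have num: "\<bar>real (A_count Q g I \<epsilon>) - real (N_count Q \<epsilon>) * measure lborel I\<bar>
       \<le> ((2 * R + 1) / \<epsilon>) ^ n * (B * \<epsilon> powr (- 2 / 3))" .
    have den: "(s / (2 * \<epsilon>)) ^ Suc n \<le> real (N_count Q \<epsilon>)"
      using s(3)[OF \<epsilon>] by (simp add: N_count_def n)
    have den0: "0 < (s / (2 * \<epsilon>)) ^ Suc n" using s \<epsilon> by simp
    have "\<bar>real (A_count Q g I \<epsilon>) / real (N_count Q \<epsilon>) - measure lborel I\<bar> =
        \<bar>real (A_count Q g I \<epsilon>) - real (N_count Q \<epsilon>) * measure lborel I\<bar> / real (N_count Q \<epsilon>)"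
    proof -
      have "real (A_count Q g I \<epsilon>) / real (N_count Q \<epsilon>) - measure lborel I =
        (real (A_count Q g I \<epsilon>) - real (N_count Q \<epsilon>) * measure lborel I) / real (N_count Q \<epsilon>)"
        using den den0 by (simp add: field_simps)
      then show ?thesis by (simp only: abs_divide abs_of_nat)
    qed
    also have "\<dots> \<le> (((2 * R + 1) / \<epsilon>) ^ n * (B * \<epsilon> powr (- 2 / 3))) / (s / (2 * \<epsilon>)) ^ Suc n"
      using num den den0 by (intro frac_le) auto
    also have "\<dots> = K * (\<epsilon> * \<epsilon> powr (- 2 / 3))"
      using \<epsilon> s by (simp add: K_def power_divide power_mult_distrib field_simps)
    also have "\<epsilon> * \<epsilon> powr (- 2 / 3) = \<epsilon> powr (1 / 3)"
      using \<epsilon> powr_add[of \<epsilon> 1 "- 2 / 3"] by simp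
    finally show "\<bar>real (A_count Q g I \<epsilon>) / real (N_count Q \<epsilon>) - measure lborel I\<bar> \<le> K * \<epsilon> powr (1 / 3)" .
  qed
qed

theorem theorem1:
  fixes \<Gamma> :: "((real ^ 'n) \<times> real) set"
    and Q :: "(real ^ 'n) set"
    and g :: "real ^ 'n \<Rightarrow> real"
    and Dg :: "real ^ 'n \<Rightarrow> real ^ 'n"
    and D2g :: "real ^ 'n \<Rightarrow> (real ^ 'n) \<Rightarrow>\<^sub>L (real ^ 'n)"
    and c\<^sub>0 C\<^sub>0 :: real
    and I :: "real \<Rightarrow> real set"
  assumes "C2_convex_surface \<Gamma>"
    and "is_cube Q"
    and "is_graph_over \<Gamma> Q g"
    and "strictly_convex_on Q g"
    and "C2_on Q g Dg D2g"
    and "0 < c\<^sub>0" and "c\<^sub>0 < C\<^sub>0"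
    and "\<And>x. x \<in> Q \<Longrightarrow> loewner_le (mat c\<^sub>0) (matrix (blinfun_apply (D2g x)))"
    and "\<And>x. x \<in> Q \<Longrightarrow> loewner_le (matrix (blinfun_apply (D2g x))) (mat C\<^sub>0)"
    and "\<And>\<epsilon>. \<epsilon> > 0 \<Longrightarrow> is_interval (I \<epsilon>)"
    and "\<And>\<epsilon>. \<epsilon> > 0 \<Longrightarrow> I \<epsilon> \<subseteq> {0..<1}"
  shows "(\<lambda>\<epsilon>. \<bar>real (A_count Q g (I \<epsilon>) \<epsilon>) / real (N_count Q \<epsilon>) - measure lborel (I \<epsilon>)\<bar>)
           \<in> O[at_right 0](\<lambda>\<epsilon>. \<epsilon> powr (1 / 3))"
proof -
  have hess: "c\<^sub>0 * (v \<bullet> v) \<le> v \<bullet> D2g x v \<and> v \<bullet> D2g x v \<le> C\<^sub>0 * (v \<bullet> v)" if "x \<in> Q" for x v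
    using hessian_quadratic_form[OF assms(8,9)[OF that]] by simp
  have "0 \<le> C\<^sub>0" using assms(6,7) by simp
  then obtain K s where s: "0 < s"
    and K: "\<And>\<epsilon> I. \<lbrakk>0 < \<epsilon>; \<epsilon> \<le> s; is_interval I; I \<subseteq> {0..<1}\<rbrakk> \<Longrightarrow>
      \<bar>real (A_count Q g I \<epsilon>) / real (N_count Q \<epsilon>) - measure lborel I\<bar> \<le> K * \<epsilon> powr (1 / 3)"
    using lattice_discrepancy[OF is_cube_convex_body[OF assms(2)] assms(5,6) _ hess] by metis
  show ?thesis
  proof (rule bigoI)
    have "\<forall>\<^sub>F \<epsilon> in at_right (0::real). \<epsilon> \<in> {0<..<s}"
      using s by (rule eventually_at_right_real)
    then show "\<forall>\<^sub>F \<epsilon> in at_right 0. norm \<bar>real (A_count Q g (I \<epsilon>) \<epsilon>) / real (N_count Q \<epsilon>) - measure lborel (I \<epsilon>)\<bar>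
        \<le> K * norm (\<epsilon> powr (1 / 3))"
    proof eventually_elim
      case (elim \<epsilon>)
      then show ?case using K[of \<epsilon> "I \<epsilon>"] assms(10,11)[of \<epsilon>] by simp
    qed
  qed
qed

end
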